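(* Let $n\ge 1$ and let $w\in H^2_{loc}(\mathbb{R}^n)$ be such that $\Delta w\equiv C$ for some constant $C\in(-\infty,-1]\cup[1,\infty)$. Then $w$ is a global minimizer of $\mathcal{F}$.
   Context: For $\Omega\subset\mathbb{R}^n$ open and bounded and $u\in H^2(\Omega)$, the two-sided biharmonic Alt-Caffarelli functional is $\mathcal{F}(u,\Omega):=\int_\Omega(\Delta u)^2\,\mathrm{d}x+|\{x\in\Omega:u(x)\neq 0\}|$, where $|\cdot|$ is Lebesgue measure. A function $u\in H^2_{loc}(\mathbb{R}^n)$ is a global minimizer of $\mathcal{F}$ if for all bounded open sets $\Omega\subset\mathbb{R}^n$ and all $v\in H^2(\Omega)$ with $v-u\in H^2_0(\Omega)$ one has $\mathcal{F}(u,\Omega)\le\mathcal{F}(v,\Omega)$. Here $H^2_0(\Omega)$ is the closure of $C_0^\infty(\Omega)$ in $H^2(\Omega)$. *)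

theory Defs
  imports "HOL-Analysis.Analysis"
begin

definition partial_deriv :: "'a::euclidean_space \<Rightarrow> ('a \<Rightarrow> real) \<Rightarrow> 'a \<Rightarrow> real"
  where "partial_deriv b f = (\<lambda>x. frechet_derivative f (at x) b)"

text \<open>
  A multi-index is encoded as a list of basis vectors; in particular
  \<open>iter_partial [b, c] f\<close> is the partial derivative along \<open>b\<close> of the partial
  derivative of \<open>f\<close> along \<open>c\<close>.
\<close>

definition iter_partial :: "'a::euclidean_space list \<Rightarrow> ('a \<Rightarrow> real) \<Rightarrow> 'a \<Rightarrow> real"
  where "iter_partial bs f = foldr partial_deriv bs f"

text \<open>
  Total differentiability of all iterated partial derivatives also makes all of them
  continuous, so this is the class of infinitely often continuously differentiable functions.
\<close>

definition smooth :: "('a::euclidean_space \<Rightarrow> real) \<Rightarrow> bool"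
  where "smooth f \<longleftrightarrow> (\<forall>bs \<in> lists Basis. iter_partial bs f differentiable_on UNIV)"

text \<open>Test functions on \<open>\<Omega>\<close> are regarded as functions on the whole space, extended by zero.\<close>

definition test_functions :: "'a::euclidean_space set \<Rightarrow> ('a \<Rightarrow> real) set"
  where "test_functions \<Omega> =
    {\<phi>. smooth \<phi> \<and> compact (closure {x. \<phi> x \<noteq> 0}) \<and> closure {x. \<phi> x \<noteq> 0} \<subseteq> \<Omega>}"

definition locally_integrable_on :: "('a::euclidean_space \<Rightarrow> real) \<Rightarrow> 'a set \<Rightarrow> bool"
    (infixr "locally'_integrable'_on" 46)
  where "u locally_integrable_on \<Omega> \<longleftrightarrow>
    (\<forall>K. compact K \<and> K \<subseteq> \<Omega> \<longrightarrow> u absolutely_integrable_on K)"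

definition has_weak_deriv ::
    "'a::euclidean_space set \<Rightarrow> 'a list \<Rightarrow> ('a \<Rightarrow> real) \<Rightarrow> ('a \<Rightarrow> real) \<Rightarrow> bool"
  where "has_weak_deriv \<Omega> bs u g \<longleftrightarrow>
    u locally_integrable_on \<Omega> \<and> g locally_integrable_on \<Omega> \<and>
    (\<forall>\<phi> \<in> test_functions \<Omega>.
      (LINT x|lebesgue_on \<Omega>. u x * iter_partial bs \<phi> x) =
      (- 1) ^ length bs * (LINT x|lebesgue_on \<Omega>. g x * \<phi> x))"

text \<open>
  For open \<open>\<Omega>\<close>, a weak derivative is unique up to a null set, so the choice of
  representative is immaterial wherever \<open>weak_deriv\<close> is integrated or used almost everywhere.
\<close>

definition weak_deriv ::
    "'a::euclidean_space set \<Rightarrow> 'a list \<Rightarrow> ('a \<Rightarrow> real) \<Rightarrow> 'a \<Rightarrow> real"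
  where "weak_deriv \<Omega> bs u = (SOME g. has_weak_deriv \<Omega> bs u g)"

definition weak_laplacian :: "'a::euclidean_space set \<Rightarrow> ('a \<Rightarrow> real) \<Rightarrow> 'a \<Rightarrow> real"
  where "weak_laplacian \<Omega> u = (\<lambda>x. \<Sum>b\<in>Basis. weak_deriv \<Omega> [b, b] u x)"

definition L2 :: "'a::euclidean_space set \<Rightarrow> ('a \<Rightarrow> real) set"
  where "L2 \<Omega> = {u. u \<in> borel_measurable (lebesgue_on \<Omega>) \<and>
    integrable (lebesgue_on \<Omega>) (\<lambda>x. (u x)\<^sup>2)}"

text \<open>
  Elements of the Sobolev spaces are represented by functions on the whole space whose
  values outside \<open>\<Omega>\<close> are irrelevant; functions agreeing almost everywhere are not identified.
\<close>

definition H2 :: "'a::euclidean_space set \<Rightarrow> ('a \<Rightarrow> real) set"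
  where "H2 \<Omega> = {u \<in> L2 \<Omega>.
    \<forall>bs \<in> lists Basis. length bs \<le> 2 \<longrightarrow> (\<exists>g \<in> L2 \<Omega>. has_weak_deriv \<Omega> bs u g)}"

text \<open>
  The squared norm is the sum of the squared \<open>L2\<close> norms of \<open>u\<close>, of its gradient and of its
  Hessian (Frobenius norm); each mixed derivative occurs once for either order.
\<close>

definition H2_norm :: "'a::euclidean_space set \<Rightarrow> ('a \<Rightarrow> real) \<Rightarrow> real"
  where "H2_norm \<Omega> u =
    sqrt (\<Sum>bs \<in> {bs \<in> lists Basis. length bs \<le> 2}. LINT x|lebesgue_on \<Omega>. (weak_deriv \<Omega> bs u x)\<^sup>2)"

definition H2_0 :: "'a::euclidean_space set \<Rightarrow> ('a \<Rightarrow> real) set"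
  where "H2_0 \<Omega> = {u \<in> H2 \<Omega>. \<exists>\<phi> :: nat \<Rightarrow> 'a \<Rightarrow> real.
    (\<forall>k. \<phi> k \<in> test_functions \<Omega>) \<and> (\<lambda>k. H2_norm \<Omega> (\<lambda>x. u x - \<phi> k x)) \<longlonglongrightarrow> 0}"

definition H2_loc :: "'a::euclidean_space set \<Rightarrow> ('a \<Rightarrow> real) set"
  where "H2_loc \<Omega> = {u. \<forall>V. open V \<and> compact (closure V) \<and> closure V \<subseteq> \<Omega> \<longrightarrow> u \<in> H2 V}"

text \<open>Both terms are finite for bounded open \<open>\<Omega>\<close> and \<open>u \<in> H2 \<Omega>\<close>, so real values suffice.\<close>

definition biharmonic_AC :: "('a::euclidean_space \<Rightarrow> real) \<Rightarrow> 'a set \<Rightarrow> real"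
  where "biharmonic_AC u \<Omega> =
    (LINT x|lebesgue_on \<Omega>. (weak_laplacian \<Omega> u x)\<^sup>2) + measure lebesgue {x \<in> \<Omega>. u x \<noteq> 0}"

definition global_minimizer :: "('a::euclidean_space \<Rightarrow> real) \<Rightarrow> bool"
  where "global_minimizer u \<longleftrightarrow> u \<in> H2_loc UNIV \<and>
    (\<forall>\<Omega> v. open \<Omega> \<and> bounded \<Omega> \<and> v \<in> H2 \<Omega> \<and> (\<lambda>x. v x - u x) \<in> H2_0 \<Omega> \<longrightarrow>
      biharmonic_AC u \<Omega> \<le> biharmonic_AC v \<Omega>)"

end

theory Submission
  imports Defs
begin

text \<open>
  Write \<open>\<phi> = v - w\<close> for a competitor \<open>v\<close> on a bounded open set \<open>\<Omega>\<close>. Since \<open>\<phi>\<close> is an \<open>H2\<close>-limit of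
  test functions, whose Laplacians have mean zero, \<open>\<Delta>\<phi>\<close> has mean zero as well
  (\<open>H2_0_integral_laplacian\<close>). Hence \<open>\<Delta>v = C + \<Delta>\<phi>\<close> gives
  \<open>\<integral>(\<Delta>v)\<^sup>2 = \<integral>(\<Delta>w)\<^sup>2 + \<integral>(\<Delta>\<phi>)\<^sup>2\<close>.
  On the other hand \<open>\<Delta>v = 0\<close> almost everywhere on \<open>{v = 0}\<close> (\<open>weak_laplacian_eq_0_on_zeros\<close>), so
  \<open>\<Delta>\<phi> = -C\<close> there and \<open>\<integral>(\<Delta>\<phi>)\<^sup>2 \<ge> C\<^sup>2 |{v = 0}| \<ge> |{v = 0}|\<close>. The bending energy that \<open>v\<close> spends in
  addition to \<open>w\<close> thus pays for the measure it can gain by vanishing: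
  \<open>\<integral>(\<Delta>\<phi>)\<^sup>2 + |{v \<noteq> 0}| \<ge> |\<Omega>| \<ge> |{w \<noteq> 0}|\<close>.

  The analytic core is the first-order fact that a weak partial derivative \<open>g\<close> of \<open>u\<close> vanishes almost
  everywhere on \<open>{u = 0}\<close>; it is applied once to \<open>v\<close> and once to its first derivatives. Instead of
  mollification and a chain rule, the proof uses difference quotients. For a test function \<open>\<psi>\<close> bounded
  by 1 the map \<open>t \<mapsto> \<integral>u(x + tb) \<psi>(x) dx\<close> has derivative \<open>\<integral>g(x + tb) \<psi>(x) dx\<close>, so by the mean value theorem the
  difference quotient of \<open>u\<close>, tested against \<open>\<psi>\<close>, differs from \<open>g\<close> by at most the \<open>L1\<close> modulus of
  continuity of \<open>g\<close> under translation. By duality the difference quotients converge to \<open>g\<close> in \<open>L1\<close> of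
  a ball (\<open>weak_deriv_diff_quotient_le\<close>). They vanish at points \<open>x\<close> where \<open>u(x) = u(x + hb) = 0\<close>, and as
  \<open>h\<close> tends to zero such points exhaust \<open>{u = 0}\<close>, again by continuity of translation in \<open>L1\<close>.

  The duality \<open>integral_abs_ball_le_if_test_le\<close> needs test functions that approximate \<open>sgn f\<close>. These are
  polynomials, supplied by the Stone-Weierstrass theorem, times smooth cutoffs of a ball of the form
  \<open>exp (-1 / (n q))\<close> with a quadratic polynomial \<open>q\<close>. The same duality gives the fundamental lemma of
  the calculus of variations, hence the uniqueness of weak derivatives, which makes the chosen
  representatives \<open>weak_deriv\<close> on different domains comparable.
\<close>

section \<open>Translations and continuity in L1\<close>

lemma lebesgue_distr_translation:
  fixes a :: "'a::euclidean_space"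
  shows "distr lebesgue lebesgue (\<lambda>x. x + a) = lebesgue"
    and "(\<lambda>x. x + a) \<in> lebesgue \<rightarrow>\<^sub>M lebesgue"
proof -
  have eq: "(\<lambda>x. a + (\<Sum>j\<in>Basis. (1 * (x \<bullet> j)) *\<^sub>R j)) = (\<lambda>x. x + a)"
    by (simp add: euclidean_representation add.commute)
  show "(\<lambda>x. x + a) \<in> lebesgue \<rightarrow>\<^sub>M lebesgue"
    using lebesgue_affine_measurable[of "\<lambda>_. 1" a] unfolding eq by simp
  show "distr lebesgue lebesgue (\<lambda>x. x + a) = lebesgue"
    using lebesgue_affine_euclidean[of "\<lambda>_. 1" a] unfolding eq by (simp add: density_1)
qed

lemma continuous_imp_lebesgue_measurable:
  fixes f :: "'a::euclidean_space \<Rightarrow> real"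
  assumes "continuous_on UNIV f"
  shows "f \<in> borel_measurable lebesgue"
  using continuous_imp_measurable_on_sets_lebesgue[OF assms] by (simp add: lebesgue_on_UNIV_eq)

lemma measurable_lebesgue_shift:
  fixes a :: "'a::euclidean_space"
  assumes "f \<in> borel_measurable lebesgue"
  shows "(\<lambda>x. f (x + a)) \<in> borel_measurable lebesgue"
  using measurable_compose[OF lebesgue_distr_translation(2) assms] .

lemma integrable_lebesgue_shift:
  fixes f :: "'a::euclidean_space \<Rightarrow> real"
  assumes "integrable lebesgue f"
  shows "integrable lebesgue (\<lambda>x. f (x + a))"
proof -
  have "integrable (distr lebesgue lebesgue (\<lambda>x. x + a)) f"
    using assms by (simp add: lebesgue_distr_translation)
  then show ?thesis
    by (rule integrable_distr[OF lebesgue_distr_translation(2)])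
qed

lemma integral_lebesgue_shift:
  fixes f :: "'a::euclidean_space \<Rightarrow> real"
  assumes "f \<in> borel_measurable lebesgue"
  shows "(LINT x|lebesgue. f (x + a)) = (LINT x|lebesgue. f x)"
proof -
  have "(LINT x|lebesgue. f (x + a)) = integral\<^sup>L (distr lebesgue lebesgue (\<lambda>x. x + a)) f"
    by (rule integral_distr[symmetric, OF lebesgue_distr_translation(2) assms])
  then show ?thesis
    by (simp add: lebesgue_distr_translation)
qed

text \<open>
  Truncation in the values and in the domain at level \<open>m\<close>, which converges to \<open>f\<close> by dominated
  convergence.
\<close>

lemma L1_approx_by_bounded:
  fixes f :: "'a::euclidean_space \<Rightarrow> real"
  assumes f: "integrable lebesgue f" and e: "e > 0"
  obtains m :: nat where "(LINT x|lebesgue. \<bar>indicator (cball 0 (real m)) x * max (- real m) (min (real m) (f x)) - f x\<bar>) < e"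
proof -
  define g where "g m x = indicator (cball 0 (real m)) x * max (- real m) (min (real m) (f x))" for m x
  have fm[measurable]: "f \<in> borel_measurable lebesgue" using f by auto
  have gm[measurable]: "g m \<in> borel_measurable lebesgue" for m
    unfolding g_def by (intro borel_measurable_times borel_measurable_indicator borel_measurable_max borel_measurable_min) auto
  have "(\<lambda>m. LINT x|lebesgue. \<bar>g m x - f x\<bar>) \<longlonglongrightarrow> (LINT x::'a|lebesgue. 0)"
  proof (rule integral_dominated_convergence[where w="\<lambda>x. 2 * \<bar>f x\<bar>"])
    show "AE x in lebesgue. (\<lambda>m. \<bar>g m x - f x\<bar>) \<longlonglongrightarrow> 0"
    proof (rule AE_I2)
      fix x
      have "eventually (\<lambda>m. norm x \<le> real m \<and> \<bar>f x\<bar> \<le> real m) sequentially"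
        using filterlim_real_sequentially by (intro eventually_conj) (auto simp: filterlim_at_top)
      then have "eventually (\<lambda>m. \<bar>g m x - f x\<bar> = 0) sequentially"
        by eventually_elim (auto simp: g_def indicator_def min_def max_def)
      then show "(\<lambda>m. \<bar>g m x - f x\<bar>) \<longlonglongrightarrow> 0"
        by (rule tendsto_eventually)
    qed
    show "AE x in lebesgue. norm \<bar>g m x - f x\<bar> \<le> 2 * \<bar>f x\<bar>" for m
      by (rule AE_I2) (auto simp: g_def indicator_def min_def max_def)
  qed (use f in \<open>auto intro!: gm\<close>)
  then have "eventually (\<lambda>m. (LINT x|lebesgue. \<bar>g m x - f x\<bar>) < e) sequentially"
    using e by (intro order_tendstoD) auto
  then show thesis
    using that unfolding g_def by (auto simp: eventually_sequentially)
qed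

text \<open>
  A measurable function is an almost everywhere limit of continuous functions. After the truncation
  of \<open>L1_approx_by_bounded\<close> these continuous functions may be clamped to \<open>[-m, m]\<close> and cut off
  outside a ball without changing their limit, and dominated convergence turns pointwise into
  \<open>L1\<close> convergence.
\<close>

lemma L1_approx_by_continuous:
  fixes f :: "'a::euclidean_space \<Rightarrow> real"
  assumes f: "integrable lebesgue f" and e: "e > 0"
  obtains c and R :: real where "continuous_on UNIV c" "\<And>x. norm x > R \<Longrightarrow> c x = 0"
    "integrable lebesgue c" "(LINT x|lebesgue. \<bar>c x - f x\<bar>) < e"
proof -
  obtain m :: nat where m: "(LINT x|lebesgue. \<bar>indicator (cball 0 (real m)) x * max (- real m) (min (real m) (f x)) - f x\<bar>) < e/2"
    using L1_approx_by_bounded[OF f, of "e/2"] e by auto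
  define F where "F x = indicator (cball 0 (real m)) x * max (- real m) (min (real m) (f x))" for x :: 'a
  have fm[measurable]: "f \<in> borel_measurable lebesgue" using f by auto
  have Fm[measurable]: "F \<in> borel_measurable lebesgue"
    unfolding F_def by (intro borel_measurable_times borel_measurable_indicator borel_measurable_max borel_measurable_min) auto
  have "F measurable_on UNIV"
    by (rule lebesgue_measurable_imp_measurable_on) auto
  then obtain N g where N: "negligible N" and gc: "\<And>n. continuous_on UNIV (g n)"
    and glim: "\<And>x. x \<notin> N \<Longrightarrow> (\<lambda>n. g n x) \<longlonglongrightarrow> F x"
    unfolding measurable_on_def by auto
  define k where "k x = max 0 (min 1 (real m + 1 - norm x))" for x :: 'a
  define c where "c n x = k x * max (- real m) (min (real m) (g n x))" for n x
  have cc: "continuous_on UNIV (c n)" for n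
    unfolding c_def k_def by (intro continuous_intros gc)
  have c0: "norm x > real m + 1 \<Longrightarrow> c n x = 0" for n x
    by (auto simp: c_def k_def)
  have cm[measurable]: "c n \<in> borel_measurable lebesgue" for n
    by (rule continuous_imp_lebesgue_measurable[OF cc])
  have cb: "\<bar>c n x\<bar> \<le> real m * indicator (cball 0 (real m + 1)) x" for n x
  proof (cases "norm x > real m + 1")
    case False
    have "\<bar>k x\<bar> \<le> 1" "\<bar>max (- real m) (min (real m) (g n x))\<bar> \<le> real m"
      by (auto simp: k_def)
    then have "\<bar>k x\<bar> * \<bar>max (- real m) (min (real m) (g n x))\<bar> \<le> 1 * real m"
      by (intro mult_mono) auto
    then show ?thesis using False by (simp add: c_def abs_mult)
  qed (simp add: c0)
  have Fb: "\<bar>F x\<bar> \<le> real m * indicator (cball 0 (real m + 1)) x" for x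
    by (auto simp: F_def indicator_def)
  have iB: "integrable lebesgue (\<lambda>x::'a. real m * indicator (cball 0 (real m + 1)) x)"
    by (intro integrable_mult_right integrable_real_indicator) 
       (use emeasure_lborel_cball_finite in \<open>auto simp: less_top\<close>)
  have Fi: "integrable lebesgue F"
    by (rule Bochner_Integration.integrable_bound[OF iB]) (use Fb in \<open>auto intro: order_trans\<close>)
  have ci: "integrable lebesgue (c n)" for n
    by (rule Bochner_Integration.integrable_bound[OF iB]) (use cb in \<open>auto intro: order_trans\<close>)
  have "(\<lambda>n. LINT x|lebesgue. \<bar>c n x - F x\<bar>) \<longlonglongrightarrow> (LINT x::'a|lebesgue. 0)"
  proof (rule integral_dominated_convergence[where w="\<lambda>x. 2 * (real m * indicator (cball 0 (real m + 1)) x)"])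
    have "AE x in lebesgue. x \<notin> N"
      using N by (simp add: AE_not_in negligible_iff_null_sets)
    then show "AE x in lebesgue. (\<lambda>n. \<bar>c n x - F x\<bar>) \<longlonglongrightarrow> 0"
    proof eventually_elim
      case (elim x)
      have "k x * max (- real m) (min (real m) (F x)) = F x"
        by (auto simp: F_def k_def indicator_def)
      moreover have "(\<lambda>n. c n x) \<longlonglongrightarrow> k x * max (- real m) (min (real m) (F x))"
        unfolding c_def by (intro tendsto_intros glim elim)
      ultimately have "(\<lambda>n. c n x) \<longlonglongrightarrow> F x"
        by simp
      then have "(\<lambda>n. \<bar>c n x - F x\<bar>) \<longlonglongrightarrow> \<bar>F x - F x\<bar>"
        by (intro tendsto_rabs tendsto_diff tendsto_const)
      then show ?case by simp
    qed
    show "AE x in lebesgue. norm \<bar>c n x - F x\<bar> \<le> 2 * (real m * indicator (cball 0 (real m + 1)) x)" for n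
      using cb[of n] Fb by (intro AE_I2) (smt (verit) real_norm_def)
  qed (use iB in auto)
  then have "eventually (\<lambda>n. (LINT x|lebesgue. \<bar>c n x - F x\<bar>) < e/2) sequentially"
    using e by (intro order_tendstoD) auto
  then obtain n where n: "(LINT x|lebesgue. \<bar>c n x - F x\<bar>) < e/2"
    by (auto simp: eventually_sequentially)
  have "(LINT x|lebesgue. \<bar>c n x - f x\<bar>) \<le> (LINT x|lebesgue. \<bar>c n x - F x\<bar> + \<bar>F x - f x\<bar>)"
    by (intro integral_mono) (use f Fi ci in auto)
  also have "\<dots> = (LINT x|lebesgue. \<bar>c n x - F x\<bar>) + (LINT x|lebesgue. \<bar>F x - f x\<bar>)"
    by (intro Bochner_Integration.integral_add) (use f Fi ci in auto)
  also have "\<dots> < e"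
    using n m unfolding F_def by simp
  finally show thesis
    using that[OF cc c0 ci] by blast
qed

text \<open>
  Clear for continuous functions of bounded support by uniform continuity; the general case follows by
  density, because translation preserves the \<open>L1\<close> distance.
\<close>

lemma L1_translation_continuous:
  fixes f :: "'a::euclidean_space \<Rightarrow> real"
  assumes f: "integrable lebesgue f" and e: "e > 0"
  obtains d where "d > 0" "\<And>a. norm a < d \<Longrightarrow> (LINT x|lebesgue. \<bar>f (x + a) - f x\<bar>) < e"
proof -
  obtain c and R :: real where cc: "continuous_on UNIV c" and c0: "\<And>x. norm x > R \<Longrightarrow> c x = 0"
    and ci: "integrable lebesgue c" and cf: "(LINT x|lebesgue. \<bar>c x - f x\<bar>) < e/3"
    using L1_approx_by_continuous[OF f, of "e/3"] e by auto
  let ?B = "cball 0 (\<bar>R\<bar> + 1) :: 'a set"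
  define V where "V = measure lebesgue ?B + 1"
  have V: "V > 0" by (simp add: V_def add_nonneg_pos)
  have "uniformly_continuous_on (cball 0 (\<bar>R\<bar> + 2)) c"
    by (intro compact_uniformly_continuous continuous_on_subset[OF cc]) auto
  then obtain d where d: "d > 0" and dc: "\<And>x y. x \<in> cball 0 (\<bar>R\<bar> + 2) \<Longrightarrow> y \<in> cball 0 (\<bar>R\<bar> + 2) \<Longrightarrow> dist x y < d
      \<Longrightarrow> dist (c x) (c y) < e / (3 * V)"
    unfolding uniformly_continuous_on_def using e V
    by (metis divide_pos_pos mult_pos_pos zero_less_numeral dist_commute)
  show thesis
  proof
    show "min d 1 > 0" using d by simp
    fix a :: 'a assume a: "norm a < min d 1"
    have pt: "\<bar>c (x + a) - c x\<bar> \<le> e / (3 * V) * indicator ?B x" for x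
    proof (cases "x \<in> ?B")
      case True
      then have "norm (x + a) \<le> \<bar>R\<bar> + 2"
        using norm_triangle_ineq[of x a] a by simp
      moreover have "x \<in> cball 0 (\<bar>R\<bar> + 2)" "dist (x + a) x < d"
        using True a by (auto simp: dist_norm)
      ultimately have "dist (c (x + a)) (c x) < e / (3 * V)"
        by (intro dc) simp_all
      then show ?thesis using True by (simp add: dist_real_def)
    next
      case False
      then have "norm x > R" "norm (x + a) > R"
        using norm_triangle_ineq2[of x "-a"] a by auto
      then show ?thesis using False c0 by simp
    qed
    note sh = integrable_lebesgue_shift[where a=a]
    have Bi: "integrable lebesgue (\<lambda>x. e / (3 * V) * indicator ?B x)"
      by (intro integrable_mult_right integrable_real_indicator) 
       (use emeasure_lborel_cball_finite in \<open>auto simp: less_top\<close>)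
    have "(LINT x|lebesgue. \<bar>c (x + a) - c x\<bar>) \<le> (LINT x|lebesgue. e / (3 * V) * indicator ?B x)"
      by (intro integral_mono Bi) (use ci sh[OF ci] pt in auto)
    also have "\<dots> = e / (3 * V) * measure lebesgue ?B"
      by simp
    also have "\<dots> < e / (3 * V) * V"
      using e V by (intro mult_strict_left_mono) (auto simp: V_def)
    finally have 2: "(LINT x|lebesgue. \<bar>c (x + a) - c x\<bar>) < e / 3"
      using V by simp
    have 3: "(LINT x|lebesgue. \<bar>c (x + a) - f (x + a)\<bar>) < e/3"
      using integral_lebesgue_shift[of "\<lambda>x. \<bar>c x - f x\<bar>" a] cf ci f by auto
    have "(LINT x|lebesgue. \<bar>f (x + a) - f x\<bar>) 
      \<le> (LINT x|lebesgue. \<bar>c (x + a) - f (x + a)\<bar> + \<bar>c (x + a) - c x\<bar> + \<bar>c x - f x\<bar>)"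
      by (intro integral_mono) (use f ci sh[OF ci] sh[OF f] in auto)
    also have "\<dots> = (LINT x|lebesgue. \<bar>c (x + a) - f (x + a)\<bar>) + (LINT x|lebesgue. \<bar>c (x + a) - c x\<bar>)
       + (LINT x|lebesgue. \<bar>c x - f x\<bar>)"
      by (subst Bochner_Integration.integral_add Bochner_Integration.integral_add; (use f ci sh[OF ci] sh[OF f] in auto))+
    finally show "(LINT x|lebesgue. \<bar>f (x + a) - f x\<bar>) < e"
      using 2 3 cf by simp
  qed
qed

section \<open>Smooth functions\<close>

lemma iter_partial_Nil [simp]: "iter_partial [] f = f"
  by (simp add: iter_partial_def)

lemma iter_partial_Cons [simp]: "iter_partial (b # bs) f = partial_deriv b (iter_partial bs f)"
  by (simp add: iter_partial_def)

lemma iter_partial_snoc: "iter_partial (bs @ [b]) f = iter_partial bs (partial_deriv b f)"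
  by (simp add: iter_partial_def)

text \<open>
  Smoothness of a whole family is easier to prove than that of one function: it suffices to exhibit a
  set of differentiable functions that is stable under partial derivatives.
\<close>

lemma smooth_coinduct:
  fixes f :: "'a::euclidean_space \<Rightarrow> real"
  assumes "f \<in> S"
    and diff: "\<And>g. g \<in> S \<Longrightarrow> g differentiable_on UNIV"
    and closed: "\<And>g b. g \<in> S \<Longrightarrow> b \<in> Basis \<Longrightarrow> partial_deriv b g \<in> S"
  shows "smooth f"
proof -
  have "iter_partial bs f \<in> S" if "bs \<in> lists Basis" for bs
    using that by (induction bs) (auto simp: assms)
  then show ?thesis
    using diff by (auto simp: smooth_def)
qed

lemma smooth_imp_differentiable:
  assumes "smooth f"
  shows "f differentiable (at x)"
proof -
  have "iter_partial [] f differentiable_on UNIV"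
    using assms unfolding smooth_def by blast
  then show ?thesis
    by (simp add: differentiable_on_def)
qed

lemma smooth_partial_deriv:
  assumes "smooth f" "b \<in> Basis"
  shows "smooth (partial_deriv b f)"
  unfolding smooth_def
proof
  fix bs :: "'a list" assume "bs \<in> lists Basis"
  then have "iter_partial (bs @ [b]) f differentiable_on UNIV"
    using assms unfolding smooth_def by simp
  then show "iter_partial bs (partial_deriv b f) differentiable_on UNIV"
    by (simp only: iter_partial_snoc)
qed

lemma partial_deriv_eqI:
  assumes "(f has_derivative f') (at x)"
  shows "partial_deriv b f x = f' b"
  using frechet_derivative_at[OF assms] by (simp add: partial_deriv_def)

lemma has_derivative_frechet_at:
  assumes "f differentiable (at x)"
  shows "(f has_derivative frechet_derivative f (at x)) (at x)"
  using assms frechet_derivative_works by blast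

lemma partial_deriv_add:
  assumes "f differentiable (at x)" "g differentiable (at x)"
  shows "partial_deriv b (\<lambda>x. f x + g x) x = partial_deriv b f x + partial_deriv b g x"
  using partial_deriv_eqI[OF has_derivative_add[OF has_derivative_frechet_at[OF assms(1)] has_derivative_frechet_at[OF assms(2)]]]
  by (simp add: partial_deriv_def)

lemma partial_deriv_mult:
  assumes "f differentiable (at x)" "g differentiable (at x)"
  shows "partial_deriv b (\<lambda>x. f x * g x) x = f x * partial_deriv b g x + partial_deriv b f x * g x"
  using partial_deriv_eqI[OF has_derivative_mult[OF has_derivative_frechet_at[OF assms(1)] has_derivative_frechet_at[OF assms(2)]]]
  by (simp add: partial_deriv_def)

lemma partial_deriv_linear:
  assumes "bounded_linear f"
  shows "partial_deriv b f = (\<lambda>x. f b)"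
  using partial_deriv_eqI[OF bounded_linear_imp_has_derivative[OF assms]] by blast

lemma partial_deriv_const: "partial_deriv b (\<lambda>x. c) = (\<lambda>x. 0)"
  using partial_deriv_eqI[OF has_derivative_const] by blast

lemma partial_deriv_compose_real:
  fixes E :: "real \<Rightarrow> real"
  assumes "f differentiable (at x)" "(E has_real_derivative E') (at (f x))"
  shows "(\<lambda>x. E (f x)) differentiable (at x)" "partial_deriv b (\<lambda>x. E (f x)) x = E' * partial_deriv b f x"
proof -
  have "((\<lambda>x. E (f x)) has_derivative (\<lambda>y. E' * frechet_derivative f (at x) y)) (at x)"
    using has_derivative_compose[OF has_derivative_frechet_at[OF assms(1)], of E "(*) E'"] assms(2)
    by (simp add: has_field_derivative_def)
  then show "(\<lambda>x. E (f x)) differentiable (at x)" "partial_deriv b (\<lambda>x. E (f x)) x = E' * partial_deriv b f x"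
    using partial_deriv_eqI by (auto simp: differentiable_def) (auto simp: partial_deriv_def)
qed

section \<open>Smooth cutoffs times polynomials\<close>

lemma real_polynomial_function_partial_deriv:
  fixes p :: "'a::euclidean_space \<Rightarrow> real"
  assumes "real_polynomial_function p"
  shows "real_polynomial_function (partial_deriv b p)"
  using assms
proof induction
  case (linear f)
  then show ?case by (simp add: partial_deriv_linear real_polynomial_function.intros(2))
next
  case (const c)
  then show ?case by (simp add: partial_deriv_const real_polynomial_function.intros(2))
next
  case (add f g)
  have "partial_deriv b (\<lambda>x. f x + g x) = (\<lambda>x. partial_deriv b f x + partial_deriv b g x)"
    using add.hyps by (intro ext partial_deriv_add differentiable_at_real_polynomial_function)
  then show ?case using add by (simp add: real_polynomial_function.intros(3))
next
  case (mult f g)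
  have "partial_deriv b (\<lambda>x. f x * g x) = (\<lambda>x. f x * partial_deriv b g x + partial_deriv b f x * g x)"
    using mult.hyps by (intro ext partial_deriv_mult differentiable_at_real_polynomial_function)
  then show ?case using mult by (auto intro!: real_polynomial_function.intros(3) real_polynomial_function.intros(4))
qed

text \<open>
  The functions \<open>P(1/t) exp(-1/t)\<close> for \<open>t > 0\<close>, continued by zero. Allowing an arbitrary polynomial \<open>P\<close>
  makes the family stable under differentiation; \<open>P = 1\<close> is the classical smooth function that is
  flat at the origin.
\<close>

definition exp_flat :: "real poly \<Rightarrow> real \<Rightarrow> real"
  where "exp_flat P t = (if t > 0 then poly P (1 / t) * exp (- (1 / t)) else 0)"

text \<open>
  This is the difference quotient at the origin; with \<open>s = 1/t\<close> it is the fact that \<open>exp s\<close>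
  outgrows every polynomial.
\<close>

lemma exp_flat_over_tendsto_0: "((\<lambda>t. exp_flat P t / t) \<longlongrightarrow> 0) (at 0)"
proof -
  have lim: "((\<lambda>s::real. poly Q s / exp s) \<longlongrightarrow> 0) at_top" for Q
  proof (induction Q)
    case (pCons a Q)
    have sum: "poly R s / exp s = (\<Sum>i\<le>degree R. coeff R i * (s ^ i / exp s))" for R and s :: real
      by (simp add: poly_altdef sum_divide_distrib)
    have "((\<lambda>s. \<Sum>i\<le>degree (pCons a Q). coeff (pCons a Q) i * (s ^ i / exp s)) \<longlongrightarrow> 
        (\<Sum>i\<le>degree (pCons a Q). coeff (pCons a Q) i * 0)) at_top"
      by (intro tendsto_intros tendsto_power_div_exp_0)
    then show ?case unfolding sum by simp
  qed simp
  have "((\<lambda>t. exp_flat P t / t) \<longlongrightarrow> 0) (at_right 0)"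
  proof (rule Lim_transform_eventually)
    show "((\<lambda>t. poly (pCons 0 P) (inverse t) / exp (inverse t)) \<longlongrightarrow> 0) (at_right 0)"
      by (rule filterlim_compose[OF lim filterlim_inverse_at_top_right])
    show "\<forall>\<^sub>F t in at_right 0. poly (pCons 0 P) (inverse t) / exp (inverse t) = exp_flat P t / t"
      by (intro eventually_at_rightI[of 0 1]) (auto simp: exp_flat_def exp_minus field_simps)
  qed
  moreover have "((\<lambda>t. exp_flat P t / t) \<longlongrightarrow> 0) (at_left 0)"
    by (rule tendsto_eventually) (auto intro!: eventually_at_leftI[of "-1"] simp: exp_flat_def)
  ultimately show ?thesis
    by (simp add: filterlim_split_at)
qed

lemma exp_flat_has_derivative:
  "(exp_flat P has_real_derivative exp_flat ([:0, 0, 1:] * (P - pderiv P)) t) (at t)"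
proof -
  let ?D = "exp_flat ([:0, 0, 1:] * (P - pderiv P)) t"
  consider "t > 0" | "t < 0" | "t = 0" by linarith
  then show ?thesis
  proof cases
    case 1
    have "((\<lambda>t. poly P (1 / t) * exp (- (1 / t))) has_real_derivative ?D) (at t)"
      using 1 by (auto intro!: derivative_eq_intros simp: exp_flat_def field_simps power2_eq_square)
    moreover have "eventually (\<lambda>s. poly P (1 / s) * exp (- (1 / s)) = exp_flat P s) (nhds t)"
      using eventually_nhds_in_open[of "{0<..}" t] 1 by (auto simp: exp_flat_def elim!: eventually_mono)
    ultimately show ?thesis
      by (subst (asm) DERIV_cong_ev[OF refl _ refl]) 
  next
    case 2
    have "((\<lambda>t. 0) has_real_derivative ?D) (at t)"
      using 2 by (auto simp: exp_flat_def)
    moreover have "eventually (\<lambda>s. 0 = exp_flat P s) (nhds t)"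
      using eventually_nhds_in_open[of "{..<0}" t] 2 by (auto simp: exp_flat_def elim!: eventually_mono)
    ultimately show ?thesis
      by (subst (asm) DERIV_cong_ev[OF refl _ refl]) 
  next
    case 3
    then show ?thesis
      using exp_flat_over_tendsto_0[of P] by (simp add: has_field_derivative_iff exp_flat_def)
  qed
qed

text \<open>
  A set to which \<open>smooth_coinduct\<close> applies. Sums have to be included because the product rule leads from
  one product to a sum of two.
\<close>

inductive_set flat_span :: "('a::euclidean_space \<Rightarrow> real) \<Rightarrow> ('a \<Rightarrow> real) set" for q
  where base: "real_polynomial_function p \<Longrightarrow> (\<lambda>x. exp_flat P (q x) * p x) \<in> flat_span q"
  | add: "f \<in> flat_span q \<Longrightarrow> g \<in> flat_span q \<Longrightarrow> (\<lambda>x. f x + g x) \<in> flat_span q"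

lemma flat_span_closed:
  assumes q: "real_polynomial_function q" and "f \<in> flat_span q"
  shows "(\<forall>x. f differentiable (at x)) \<and> partial_deriv b f \<in> flat_span q"
  using assms(2)
proof induction
  case (base p P)
  let ?P = "[:0, 0, 1:] * (P - pderiv P)"
  have E: "(\<lambda>x. exp_flat P (q x)) differentiable (at x)"
          "partial_deriv b (\<lambda>x. exp_flat P (q x)) x = exp_flat ?P (q x) * partial_deriv b q x" for x
    by (rule partial_deriv_compose_real[OF differentiable_at_real_polynomial_function[OF q] exp_flat_has_derivative])+
  note p = differentiable_at_real_polynomial_function[OF base]
  have "partial_deriv b (\<lambda>x. exp_flat P (q x) * p x) =
      (\<lambda>x. exp_flat P (q x) * partial_deriv b p x + exp_flat ?P (q x) * (partial_deriv b q x * p x))"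
    unfolding partial_deriv_mult[OF E(1) p] E(2) mult.assoc ..
  moreover have "\<dots> \<in> flat_span q"
    by (intro flat_span.add flat_span.base real_polynomial_function.intros(4) real_polynomial_function_partial_deriv base q)
  ultimately show ?case
    using differentiable_mult[OF E(1) p] by simp
next
  case (add f g)
  have "partial_deriv b (\<lambda>x. f x + g x) = (\<lambda>x. partial_deriv b f x + partial_deriv b g x)"
    using add.IH by (intro ext partial_deriv_add) blast+
  then show ?case
    using add.IH by (simp add: flat_span.add differentiable_add)
qed

lemma smooth_exp_flat:
  assumes "real_polynomial_function q" "real_polynomial_function p"
  shows "smooth (\<lambda>x. exp_flat P (q x) * p x)"
  by (rule smooth_coinduct[where S="flat_span q"])
    (use assms flat_span_closed[OF assms(1)] in \<open>simp_all add: flat_span.base differentiable_on_def\<close>)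

section \<open>Translates and test functions\<close>

lemma smooth_shift:
  assumes "smooth f"
  shows "smooth (\<lambda>x. f (x + a))" and "partial_deriv b (\<lambda>x. f (x + a)) x = partial_deriv b f (x + a)"
proof -
  have d: "(\<lambda>x. f (x + a)) differentiable (at x) \<and> partial_deriv b (\<lambda>x. f (x + a)) x = partial_deriv b f (x + a)"
    if "smooth f" for f x b
  proof -
    have "((\<lambda>x. f (x + a)) has_derivative (\<lambda>y. frechet_derivative f (at (x + a)) y)) (at x)"
      by (rule has_derivative_compose[OF _ has_derivative_frechet_at[OF smooth_imp_differentiable[OF that]]])
        (auto intro!: derivative_eq_intros)
    from partial_deriv_eqI[OF this] differentiableI[OF this] show ?thesis
      by (simp add: partial_deriv_def)
  qed
  show "partial_deriv b (\<lambda>x. f (x + a)) x = partial_deriv b f (x + a)"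
    using d[OF assms] by blast
  show "smooth (\<lambda>x. f (x + a))"
  proof (rule smooth_coinduct[where S="{\<lambda>x. f (x + a) | f. smooth f}"])
    fix g and b :: 'a assume "g \<in> {\<lambda>x. f (x + a) | f. smooth f}" "b \<in> Basis"
    then obtain f where g: "g = (\<lambda>x. f (x + a))" "smooth f" by blast
    then have "partial_deriv b g = (\<lambda>x. partial_deriv b f (x + a))"
      using d by blast
    with g show "partial_deriv b g \<in> {\<lambda>x. f (x + a) | f. smooth f}"
      using smooth_partial_deriv[OF g(2) \<open>b \<in> Basis\<close>] by blast
  next
    show "(\<lambda>x. f (x + a)) \<in> {\<lambda>x. f (x + a) | f. smooth f}"
      using assms by blast
  next
    fix g assume "g \<in> {\<lambda>x. f (x + a) | f. smooth f}"
    then obtain f where "g = (\<lambda>x. f (x + a))" "smooth f" by blast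
    then show "g differentiable_on UNIV"
      using d[of f] by (simp add: differentiable_on_def)
  qed
qed

lemma test_functionsI:
  assumes "smooth \<phi>" "compact K" "K \<subseteq> \<Omega>" "\<And>x. x \<notin> K \<Longrightarrow> \<phi> x = 0"
  shows "\<phi> \<in> test_functions \<Omega>"
proof -
  have "closure {x. \<phi> x \<noteq> 0} \<subseteq> K"
    using assms by (intro closure_minimal compact_imp_closed) auto
  then show ?thesis
    using assms compact_Int_closed[OF assms(2) closed_closure[of "{x. \<phi> x \<noteq> 0}"]]
    by (auto simp: test_functions_def inf.absorb2)
qed

lemma test_functionsE:
  assumes "\<phi> \<in> test_functions \<Omega>"
  obtains K where "smooth \<phi>" "compact K" "K \<subseteq> \<Omega>" "\<And>x. x \<notin> K \<Longrightarrow> \<phi> x = 0"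
proof
  show "smooth \<phi>" "compact (closure {x. \<phi> x \<noteq> 0})" "closure {x. \<phi> x \<noteq> 0} \<subseteq> \<Omega>"
    using assms by (auto simp: test_functions_def)
  show "\<phi> x = 0" if "x \<notin> closure {x. \<phi> x \<noteq> 0}" for x
    using that closure_subset[of "{x. \<phi> x \<noteq> 0}"] by auto
qed

lemma test_functions_mono:
  "\<Omega> \<subseteq> \<Omega>' \<Longrightarrow> \<phi> \<in> test_functions \<Omega> \<Longrightarrow> \<phi> \<in> test_functions \<Omega>'"
  by (auto simp: test_functions_def)

lemma partial_deriv_eq_0_outside:
  assumes "closed K" "\<And>x. x \<notin> K \<Longrightarrow> f x = 0" "x \<notin> K"
  shows "partial_deriv b f x = 0"
proof -
  have "(f has_derivative (\<lambda>y. 0)) (at x)"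
    by (rule has_derivative_transform_within_open[of "\<lambda>x. 0" _ _ _ "- K"]) (use assms in auto)
  from partial_deriv_eqI[OF this] show ?thesis by simp
qed

lemma test_functions_partial_deriv:
  assumes "\<phi> \<in> test_functions \<Omega>" "b \<in> Basis"
  shows "partial_deriv b \<phi> \<in> test_functions \<Omega>"
proof -
  obtain K where K: "smooth \<phi>" "compact K" "K \<subseteq> \<Omega>" "\<And>x. x \<notin> K \<Longrightarrow> \<phi> x = 0"
    using test_functionsE[OF assms(1)] by blast
  show ?thesis
    using partial_deriv_eq_0_outside[OF compact_imp_closed[OF K(2)] K(4)]
    by (intro test_functionsI[OF smooth_partial_deriv[OF K(1) assms(2)] K(2,3)]) auto
qed

lemma test_functions_iter_partial:
  assumes "\<phi> \<in> test_functions \<Omega>" "bs \<in> lists Basis"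
  shows "iter_partial bs \<phi> \<in> test_functions \<Omega>"
  using assms(2) by (induction bs) (auto simp: assms(1) test_functions_partial_deriv)

lemma smooth_continuous: "smooth f \<Longrightarrow> continuous_on UNIV f"
  by (intro continuous_at_imp_continuous_on ballI differentiable_imp_continuous_within smooth_imp_differentiable)

lemma test_functions_continuous: "\<phi> \<in> test_functions \<Omega> \<Longrightarrow> continuous_on UNIV \<phi>"
  by (auto simp: test_functions_def smooth_continuous)

lemma test_functions_measurable: "\<phi> \<in> test_functions \<Omega> \<Longrightarrow> \<phi> \<in> borel_measurable lebesgue"
  by (rule continuous_imp_lebesgue_measurable[OF test_functions_continuous])

lemma test_functions_bounded:
  assumes "\<phi> \<in> test_functions \<Omega>"
  obtains M where "M > 0" "\<And>x. \<bar>\<phi> x\<bar> \<le> M"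
proof -
  obtain K where K: "smooth \<phi>" "compact K" "K \<subseteq> \<Omega>" "\<And>x. x \<notin> K \<Longrightarrow> \<phi> x = 0"
    using test_functionsE[OF assms(1)] by blast
  have "compact (\<phi> ` K)"
    using K test_functions_continuous[OF assms] by (intro compact_continuous_image) (auto intro: continuous_on_subset)
  then obtain M where "M > 0" "\<And>x. x \<in> K \<Longrightarrow> \<bar>\<phi> x\<bar> \<le> M"
    using compact_imp_bounded bounded_pos[of "\<phi> ` K"] by auto
  then show thesis
    using that[of M] K(4) by (metis abs_zero less_imp_le)
qed

section \<open>Duality between L1 and test functions\<close>

lemma integrable_mult_bounded:
  fixes u f :: "'a \<Rightarrow> real"
  assumes "integrable M u" "f \<in> borel_measurable M" "\<And>x. \<bar>f x\<bar> \<le> B"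
  shows "integrable M (\<lambda>x. u x * f x)"
proof (rule Bochner_Integration.integrable_bound)
  show "integrable M (\<lambda>x. B * \<bar>u x\<bar>)" using assms by auto
  have "\<bar>u x\<bar> * \<bar>f x\<bar> \<le> \<bar>u x\<bar> * B" for x
    using assms by (intro mult_left_mono) auto
  then show "AE x in M. norm (u x * f x) \<le> norm (B * \<bar>u x\<bar>)"
    using order_trans[OF abs_ge_zero assms(3)] by (intro AE_I2) (simp add: abs_mult mult.commute)
qed (use assms in auto)

lemma exp_flat_1_bounds: "0 \<le> exp_flat 1 t" "exp_flat 1 t \<le> 1"
  by (auto simp: exp_flat_def)

lemma exp_flat_1_tendsto_1:
  assumes "t > 0"
  shows "(\<lambda>n. exp_flat 1 (real (Suc n) * t)) \<longlonglongrightarrow> 1"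
proof -
  have "(\<lambda>n. inverse (real (Suc n))) \<longlonglongrightarrow> 0"
    by (rule LIMSEQ_inverse_real_of_nat)
  then have "(\<lambda>n. exp (- (inverse (real (Suc n)) * inverse t))) \<longlonglongrightarrow> exp (- (0 * inverse t))"
    by (intro tendsto_intros)
  moreover have "exp (- (inverse (real (Suc n)) * inverse t)) = exp_flat 1 (real (Suc n) * t)" for n
    using assms by (simp add: exp_flat_def divide_inverse)
  ultimately show ?thesis by simp
qed

lemma real_polynomial_function_sq_dist:
  fixes a :: "'a::euclidean_space"
  shows "real_polynomial_function (\<lambda>x. (x - a) \<bullet> (x - a))"
proof -
  have "real_polynomial_function (\<lambda>x. x \<bullet> b - a \<bullet> b)" for b :: 'a
    by (intro real_polynomial_function_diff real_polynomial_function.intros bounded_linear_inner_left)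
  then have "real_polynomial_function (\<lambda>x. \<Sum>b\<in>Basis. (x \<bullet> b - a \<bullet> b) * (x \<bullet> b - a \<bullet> b))"
    by (intro real_polynomial_function_sum real_polynomial_function.intros(4)) auto
  moreover have "(\<Sum>b\<in>Basis. (x \<bullet> b - a \<bullet> b) * (x \<bullet> b - a \<bullet> b)) = (x - a) \<bullet> (x - a)" for x
    by (subst euclidean_inner) (simp add: inner_diff_left)
  ultimately show ?thesis by simp
qed

text \<open>
  The \<open>L1\<close> norm on a ball is the supremum of the pairings with test functions bounded by 1. Continuous
  functions converge to \<open>sgn f\<close> almost everywhere; clamped to \<open>[-1, 1]\<close>, uniformly approximated by
  polynomials, rescaled so as to stay within \<open>[-1, 1]\<close>, and multiplied by cutoffs that increase to the
  indicator of the ball, they become admissible test functions with the same limit in the ball.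
\<close>

lemma integral_abs_ball_le_if_test_le:
  fixes f :: "'a::euclidean_space \<Rightarrow> real"
  assumes f: "integrable lebesgue f"
    and le: "\<And>\<phi>. smooth \<phi> \<Longrightarrow> (\<And>x. x \<notin> cball a r \<Longrightarrow> \<phi> x = 0) \<Longrightarrow> (\<And>x. \<bar>\<phi> x\<bar> \<le> 1)
      \<Longrightarrow> \<bar>LINT x|lebesgue. f x * \<phi> x\<bar> \<le> c"
    and r: "r > 0"
  shows "(LINT x|lebesgue. indicator (ball a r) x * \<bar>f x\<bar>) \<le> c"
proof -
  have fm[measurable]: "f \<in> borel_measurable lebesgue" using f by auto
  have "(\<lambda>x. sgn (f x)) \<in> borel_measurable lebesgue"
    by measurable
  then have "(\<lambda>x. sgn (f x)) measurable_on UNIV"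
    by (intro lebesgue_measurable_imp_measurable_on) auto
  then obtain N g where N: "negligible N" and gc: "\<And>n. continuous_on UNIV (g n)"
    and glim: "\<And>x. x \<notin> N \<Longrightarrow> (\<lambda>n. g n x) \<longlonglongrightarrow> sgn (f x)"
    unfolding measurable_on_def by auto
  define s where "s n x = max (- 1) (min 1 (g n x))" for n x
  have sc: "continuous_on (cball a r) (s n)" for n
    unfolding s_def by (intro continuous_intros continuous_on_subset[OF gc]) auto
  have "\<exists>p. real_polynomial_function p \<and> (\<forall>x\<in>cball a r. \<bar>s n x - p x\<bar> < inverse (real (Suc n)))" for n
    using Stone_Weierstrass_real_polynomial_function[OF compact_cball sc, of "inverse (real (Suc n))" n]
    by (metis inverse_positive_iff_positive of_nat_0_less_iff zero_less_Suc)
  then obtain p where p: "\<And>n. real_polynomial_function (p n)"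
    and ps: "\<And>n x. x \<in> cball a r \<Longrightarrow> \<bar>s n x - p n x\<bar> < inverse (real (Suc n))"
    by metis
  \<comment> \<open>q is positive exactly in the open ball, where the cutoffs exp (-1 / ((n + 1) q)) increase to 1.\<close>
  define q where "q x = r\<^sup>2 - (x - a) \<bullet> (x - a)" for x
  have q: "real_polynomial_function q"
    unfolding q_def by (intro real_polynomial_function_diff real_polynomial_function.intros real_polynomial_function_sq_dist)
  have q_pos: "q x > 0 \<longleftrightarrow> x \<in> ball a r" for x
    using r power2_less_imp_less[of "norm (a - x)" r] power_strict_mono[of "norm (a - x)" r 2]
    by (auto simp: q_def dist_norm norm_minus_commute power2_norm_eq_inner[symmetric])
  \<comment> \<open>the last factor compensates the approximation error, by which the polynomial may exceed 1\<close>
  define \<phi> where "\<phi> n x = exp_flat 1 (real (Suc n) * q x) * (p n x * inverse (1 + inverse (real (Suc n))))" for n x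
  have smooth: "smooth (\<phi> n)" for n
    unfolding \<phi>_def by (intro smooth_exp_flat real_polynomial_function.intros(2,4) p q)
  have out: "\<phi> n x = 0" if "x \<notin> ball a r" for n x
  proof -
    have "real (Suc n) * q x \<le> 0"
      using that q_pos[of x] by (intro mult_nonneg_nonpos) auto
    then show ?thesis by (simp add: \<phi>_def exp_flat_def)
  qed
  have bd: "\<bar>\<phi> n x\<bar> \<le> 1" for n x
  proof (cases "x \<in> ball a r")
    case True
    let ?k = "1 + inverse (real (Suc n))"
    have k: "?k > 0" by (intro add_pos_pos) auto
    have "\<bar>s n x\<bar> \<le> 1" by (auto simp: s_def)
    then have "\<bar>p n x\<bar> \<le> ?k"
      using ps[of x n] True by (simp add: ball_subset_cball[THEN subsetD])
    then have "\<bar>p n x * inverse ?k\<bar> \<le> 1"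
      using k by (simp only: abs_divide abs_of_pos divide_le_eq_1_pos flip: divide_inverse)
    then have "\<bar>exp_flat 1 (real (Suc n) * q x)\<bar> * \<bar>p n x * inverse ?k\<bar> \<le> 1 * 1"
      using exp_flat_1_bounds by (intro mult_mono) auto
    then show ?thesis by (simp add: \<phi>_def abs_mult)
  qed (simp add: out)
  have \<phi>m[measurable]: "\<phi> n \<in> borel_measurable lebesgue" for n
    by (rule continuous_imp_lebesgue_measurable[OF smooth_continuous[OF smooth]])
  have lim: "(\<lambda>n. LINT x|lebesgue. f x * \<phi> n x) \<longlonglongrightarrow> (LINT x|lebesgue. indicator (ball a r) x * \<bar>f x\<bar>)"
  proof (rule integral_dominated_convergence[where w="\<lambda>x. \<bar>f x\<bar>"])
    have "AE x in lebesgue. x \<notin> N"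
      using N by (simp add: AE_not_in negligible_iff_null_sets)
    then show "AE x in lebesgue. (\<lambda>n. f x * \<phi> n x) \<longlonglongrightarrow> indicator (ball a r) x * \<bar>f x\<bar>"
    proof eventually_elim
      case (elim x)
      show ?case
      proof (cases "x \<in> ball a r")
        case True
        have inv: "(\<lambda>n. inverse (real (Suc n))) \<longlonglongrightarrow> 0"
          by (rule LIMSEQ_inverse_real_of_nat)
        have "(\<lambda>n. s n x) \<longlonglongrightarrow> max (- 1) (min 1 (sgn (f x)))"
          unfolding s_def by (intro tendsto_intros glim elim)
        then have "(\<lambda>n. s n x) \<longlonglongrightarrow> sgn (f x)"
          by (simp add: sgn_if split: if_splits)
        moreover have "(\<lambda>n. s n x - p n x) \<longlonglongrightarrow> 0"
          by (rule Lim_null_comparison[OF _ inv]) 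
            (use ps[of x] True in \<open>auto intro!: always_eventually less_imp_le simp: ball_subset_cball[THEN subsetD]\<close>)
        ultimately have "(\<lambda>n. s n x - (s n x - p n x)) \<longlonglongrightarrow> sgn (f x) - 0"
          by (rule tendsto_diff)
        then have "(\<lambda>n. p n x) \<longlonglongrightarrow> sgn (f x)" by simp
        then have "(\<lambda>n. f x * \<phi> n x) \<longlonglongrightarrow> f x * (1 * (sgn (f x) * inverse (1 + 0)))"
          unfolding \<phi>_def using True q_pos by (intro tendsto_intros exp_flat_1_tendsto_1 inv) auto
        then show ?thesis using True by (simp add: abs_sgn mult.commute)
      qed (simp add: out)
    qed
    show "AE x in lebesgue. norm (f x * \<phi> n x) \<le> \<bar>f x\<bar>" for n
      using bd by (intro AE_I2) (auto simp: abs_mult intro: mult_left_le)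
  qed (use f in \<open>auto intro!: borel_measurable_times borel_measurable_indicator\<close>)
  have "(LINT x|lebesgue. f x * \<phi> n x) \<le> c" for n
    using le[of "\<phi> n"] smooth out bd ball_subset_cball by (smt (verit) subsetD)
  then show ?thesis
    by (intro LIMSEQ_le_const2[OF lim]) auto
qed


lemma integrable_locally_integrable:
  assumes "u locally_integrable_on \<Omega>" "compact K" "K \<subseteq> \<Omega>"
  shows "integrable lebesgue (\<lambda>x. indicator K x * u x)"
  using assms by (auto simp: locally_integrable_on_def set_integrable_def)

lemma lebesgue_on_integral_compact_support:
  fixes u f :: "'a::euclidean_space \<Rightarrow> real"
  assumes "\<Omega> \<in> sets lebesgue" "K \<subseteq> \<Omega>" "\<And>x. x \<notin> K \<Longrightarrow> f x = 0"
  shows "(LINT x|lebesgue_on \<Omega>. u x * f x) = (LINT x|lebesgue. (indicator K x * u x) * f x)"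
proof -
  have "indicator \<Omega> x *\<^sub>R (u x * f x) = (indicator K x * u x) * f x" for x
    using assms(2,3) by (cases "x \<in> K") (auto simp: indicator_def)
  moreover have "(LINT x|lebesgue_on \<Omega>. u x * f x) = (LINT x|lebesgue. indicator \<Omega> x *\<^sub>R (u x * f x))"
    using assms(1) by (intro integral_restrict_space) simp
  ultimately show ?thesis by (simp only:)
qed

lemma integrable_indicator_mult:
  fixes f :: "'a \<Rightarrow> real"
  assumes "integrable M f" "S \<in> sets M"
  shows "integrable M (\<lambda>x. indicator S x * f x)"
  using integrable_mult_indicator[OF assms(2,1)] by simp

text \<open>
  Local statements hold almost everywhere on an open set, since by the Lindelof property countably many
  of the balls cover it. The doubled radius leaves room for translations by at most \<open>r\<close>.
\<close>

lemma AE_open_if_AE_balls: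
  fixes \<Omega> :: "'a::euclidean_space set"
  assumes "open \<Omega>"
    and AE: "\<And>a r. r > 0 \<Longrightarrow> cball a (2 * r) \<subseteq> \<Omega> \<Longrightarrow> AE x in lebesgue. x \<in> ball a r \<longrightarrow> P x"
  shows "AE x in lebesgue. x \<in> \<Omega> \<longrightarrow> P x"
proof -
  define F where "F = {ball a r | a r. r > 0 \<and> cball a (2 * r) \<subseteq> \<Omega>}"
  have "\<And>S. S \<in> F \<Longrightarrow> open S" by (auto simp: F_def)
  then obtain F' where F': "F' \<subseteq> F" "countable F'" "\<Union>F' = \<Union>F"
    using Lindelof[of F] by metis
  have cover: "\<Omega> \<subseteq> \<Union>F"
  proof
    fix x assume "x \<in> \<Omega>"
    then obtain e where "e > 0" "cball x e \<subseteq> \<Omega>"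
      using \<open>open \<Omega>\<close> open_contains_cball by blast
    then have "ball x (e/2) \<in> F" "x \<in> ball x (e/2)"
      unfolding F_def by (auto intro!: exI[of _ x] exI[of _ "e/2"])
    then show "x \<in> \<Union>F" by blast
  qed
  have "AE x in lebesgue. \<forall>S\<in>F'. x \<in> S \<longrightarrow> P x"
    using F'(1) AE by (intro AE_ball_countable'[OF _ F'(2)]) (auto simp: F_def)
  then show ?thesis
    by eventually_elim (use cover F'(3) in blast)
qed

text \<open>
  The fundamental lemma of the calculus of variations, which is the duality above with bound zero.
\<close>

lemma AE_eq_0_if_test_integrals_0:
  fixes g :: "'a::euclidean_space \<Rightarrow> real"
  assumes \<Omega>: "open \<Omega>" and g: "g locally_integrable_on \<Omega>"
    and 0: "\<And>\<phi>. \<phi> \<in> test_functions \<Omega> \<Longrightarrow> (LINT x|lebesgue_on \<Omega>. g x * \<phi> x) = 0"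
  shows "AE x in lebesgue. x \<in> \<Omega> \<longrightarrow> g x = 0"
proof (rule AE_open_if_AE_balls[OF \<Omega>])
  fix a and r :: real assume r: "r > 0" and "cball a (2 * r) \<subseteq> \<Omega>"
  then have sub: "cball a r \<subseteq> \<Omega>"
    using subset_cball[of r "2 * r" a] by simp
  define G where "G = (\<lambda>x. indicator (cball a r) x * g x)"
  have Gi: "integrable lebesgue G"
    using g sub unfolding G_def by (intro integrable_locally_integrable) auto
  have "(LINT x|lebesgue. indicator (ball a r) x * \<bar>G x\<bar>) \<le> 0"
  proof (rule integral_abs_ball_le_if_test_le[OF Gi _ r])
    fix \<phi> :: "'a \<Rightarrow> real"
    assume \<phi>: "smooth \<phi>" "\<And>x. x \<notin> cball a r \<Longrightarrow> \<phi> x = 0"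
    have "(LINT x|lebesgue_on \<Omega>. g x * \<phi> x) = 0"
      by (rule 0, rule test_functionsI[OF \<phi>(1) compact_cball sub \<phi>(2)])
    moreover have "(LINT x|lebesgue_on \<Omega>. g x * \<phi> x) = (LINT x|lebesgue. G x * \<phi> x)"
      unfolding G_def using \<Omega> by (intro lebesgue_on_integral_compact_support sub \<phi>(2)) auto
    ultimately show "\<bar>LINT x|lebesgue. G x * \<phi> x\<bar> \<le> 0" by simp
  qed
  moreover have i: "integrable lebesgue (\<lambda>x. indicator (ball a r) x * \<bar>G x\<bar>)"
    using Gi by (intro integrable_indicator_mult) auto
  moreover have "(LINT x|lebesgue. indicator (ball a r) x * \<bar>G x\<bar>) \<ge> 0"
    by (intro integral_nonneg_AE) auto
  ultimately have "(LINT x|lebesgue. indicator (ball a r) x * \<bar>G x\<bar>) = 0" by linarith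
  then have "AE x in lebesgue. indicator (ball a r) x * \<bar>G x\<bar> = 0"
    using integral_nonneg_eq_0_iff_AE[OF i] by simp
  then show "AE x in lebesgue. x \<in> ball a r \<longrightarrow> g x = 0"
    by eventually_elim (auto simp: G_def indicator_def)
qed

section \<open>Weak derivatives vanish on the zero set\<close>

lemma has_real_derivative_along:
  assumes "f differentiable (at (x + t *\<^sub>R b))"
  shows "((\<lambda>t. f (x + t *\<^sub>R b)) has_real_derivative partial_deriv b f (x + t *\<^sub>R b)) (at t)"
proof -
  let ?D = "frechet_derivative f (at (x + t *\<^sub>R b))"
  have D: "(f has_derivative ?D) (at (x + t *\<^sub>R b))"
    by (rule has_derivative_frechet_at[OF assms])
  have "((\<lambda>t. f (x + t *\<^sub>R b)) has_derivative (\<lambda>s. ?D (s *\<^sub>R b))) (at t)"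
    by (rule has_derivative_compose[of "\<lambda>t. x + t *\<^sub>R b" "\<lambda>s. s *\<^sub>R b" t UNIV f ?D, OF _ D])
      (auto intro!: derivative_eq_intros)
  moreover have "?D (s *\<^sub>R b) = partial_deriv b f (x + t *\<^sub>R b) * s" for s
    using linear_cmul[OF has_derivative_linear[OF D], of s b] by (simp add: partial_deriv_def)
  ultimately show ?thesis
    by (simp add: has_field_derivative_def)
qed

text \<open>
  The translation is put on the test function, so that differentiation under the integral only needs
  the Lipschitz bound of the test function as a dominating factor.
\<close>

lemma has_real_derivative_integral_translate:
  fixes u \<phi> :: "'a::euclidean_space \<Rightarrow> real"
  assumes u: "integrable lebesgue u" and \<phi>: "\<phi> \<in> test_functions \<Omega>" and b: "b \<in> Basis"
  shows "((\<lambda>t. LINT x|lebesgue. u x * \<phi> (x + t *\<^sub>R b)) has_real_derivative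
    (LINT x|lebesgue. u x * partial_deriv b \<phi> (x + t *\<^sub>R b))) (at t)"
proof -
  let ?d = "partial_deriv b \<phi>"
  have d: "?d \<in> test_functions \<Omega>" by (rule test_functions_partial_deriv[OF \<phi> b])
  obtain M where M: "\<And>x. \<bar>\<phi> x\<bar> \<le> M" using test_functions_bounded[OF \<phi>] by blast
  obtain M' where M': "\<And>x. \<bar>?d x\<bar> \<le> M'" using test_functions_bounded[OF d] by blast
  have der: "((\<lambda>t. \<phi> (x + t *\<^sub>R b)) has_real_derivative ?d (x + t *\<^sub>R b)) (at t)" for x t
    using \<phi> by (intro has_real_derivative_along smooth_imp_differentiable) (auto simp: test_functions_def)
  have sm[measurable]: "(\<lambda>x. \<phi> (x + a)) \<in> borel_measurable lebesgue" "(\<lambda>x. ?d (x + a)) \<in> borel_measurable lebesgue" for a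
    by (rule measurable_lebesgue_shift[OF test_functions_measurable[OF \<phi>]],
        rule measurable_lebesgue_shift[OF test_functions_measurable[OF d]])
  have um[measurable]: "u \<in> borel_measurable lebesgue" using u by auto
  have i: "integrable lebesgue (\<lambda>x. u x * \<phi> (x + a))" for a
    by (rule integrable_mult_bounded[OF u _ M]) auto
  have lip: "\<bar>\<phi> (x + y *\<^sub>R b) - \<phi> (x + t *\<^sub>R b)\<bar> \<le> M' * \<bar>y - t\<bar>" for x y
    using field_differentiable_bound[of UNIV "\<lambda>t. \<phi> (x + t *\<^sub>R b)" "\<lambda>t. ?d (x + t *\<^sub>R b)" M' y t] der M'
    by (auto simp: has_field_derivative_at_within)
  show ?thesis
    unfolding has_field_derivative_iff tendsto_at_iff_sequentially
  proof (intro allI impI)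
    fix y :: "nat \<Rightarrow> real" assume y: "\<forall>i. y i \<in> UNIV - {t}" and yt: "y \<longlonglongrightarrow> t"
    have yn: "y n - t \<noteq> 0" for n using y by (metis DiffD2 UNIV_I eq_iff_diff_eq_0 insertI1)
    let ?q = "\<lambda>n x. (\<phi> (x + y n *\<^sub>R b) - \<phi> (x + t *\<^sub>R b)) / (y n - t)"
    have "(\<lambda>n. LINT x|lebesgue. u x * ?q n x) \<longlonglongrightarrow> (LINT x|lebesgue. u x * ?d (x + t *\<^sub>R b))"
    proof (rule integral_dominated_convergence[where w="\<lambda>x. \<bar>u x\<bar> * M'"])
      show "AE x in lebesgue. (\<lambda>n. u x * ?q n x) \<longlonglongrightarrow> u x * ?d (x + t *\<^sub>R b)"
      proof (intro AE_I2 tendsto_intros)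
        fix x
        have "((\<lambda>s. (\<phi> (x + s *\<^sub>R b) - \<phi> (x + t *\<^sub>R b)) / (s - t)) \<longlongrightarrow> ?d (x + t *\<^sub>R b)) (at t)"
          using der[of x t] by (simp add: has_field_derivative_iff)
        then show "(\<lambda>n. ?q n x) \<longlonglongrightarrow> ?d (x + t *\<^sub>R b)"
          unfolding tendsto_at_iff_sequentially using y yt by (auto simp: o_def)
      qed
      show "AE x in lebesgue. norm (u x * ?q n x) \<le> \<bar>u x\<bar> * M'" for n
      proof (intro AE_I2)
        fix x
        have "\<bar>?q n x\<bar> \<le> M'"
          using lip[of x "y n"] yn[of n] by (simp add: abs_divide divide_le_eq)
        then show "norm (u x * ?q n x) \<le> \<bar>u x\<bar> * M'"
          unfolding real_norm_def abs_mult by (intro mult_left_mono) auto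
      qed
    qed (use u in auto)
    moreover have "(LINT x|lebesgue. u x * ?q n x) =
      ((LINT x|lebesgue. u x * \<phi> (x + y n *\<^sub>R b)) - (LINT x|lebesgue. u x * \<phi> (x + t *\<^sub>R b))) / (y n - t)" for n
    proof -
      have "u x * ?q n x = (u x * \<phi> (x + y n *\<^sub>R b) - u x * \<phi> (x + t *\<^sub>R b)) / (y n - t)" for x
        by (simp add: right_diff_distrib)
      then show ?thesis
        by (simp only: Bochner_Integration.integral_diff[OF i i] integral_divide_zero)
    qed
    ultimately show "((\<lambda>s. ((LINT x|lebesgue. u x * \<phi> (x + s *\<^sub>R b)) - (LINT x|lebesgue. u x * \<phi> (x + t *\<^sub>R b))) / (s - t)) \<circ> y)
      \<longlonglongrightarrow> (LINT x|lebesgue. u x * ?d (x + t *\<^sub>R b))"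
      by (simp only: o_def)
  qed
qed

text \<open>
  Both \<open>u\<close> and \<open>g\<close> are cut off to the larger ball, which the translated test functions do not leave.
  Moving translations between the factors, the definition of the weak derivative says that
  \<open>A t = \<integral>U(x + tb) \<phi>(x) dx\<close> has derivative \<open>B t = \<integral>G(x + tb) \<phi>(x) dx\<close>. The mean value theorem gives
  \<open>(A h - A 0) / h - B 0 = B t - B 0\<close> for some \<open>t\<close> between 0 and \<open>h\<close>, which the \<open>L1\<close> distance of \<open>G\<close>
  and its translate controls uniformly in \<open>\<phi>\<close>.
\<close>

lemma weak_deriv_diff_quotient_le:
  fixes u g :: "'a::euclidean_space \<Rightarrow> real"
  assumes \<Omega>: "open \<Omega>" and b: "b \<in> Basis" and wd: "has_weak_deriv \<Omega> [b] u g"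
    and r: "r > 0" and sub: "cball a (2 * r) \<subseteq> \<Omega>" and h: "0 < h" "h \<le> r"
    and U: "U = (\<lambda>x. indicator (cball a (2 * r)) x * u x)"
    and G: "G = (\<lambda>x. indicator (cball a (2 * r)) x * g x)"
    and le: "\<And>t. 0 < t \<Longrightarrow> t < h \<Longrightarrow> (LINT x|lebesgue. \<bar>G (x + t *\<^sub>R b) - G x\<bar>) \<le> \<epsilon>"
  shows "(LINT x|lebesgue. indicator (ball a r) x * \<bar>(U (x + h *\<^sub>R b) - U x) / h - G x\<bar>) \<le> \<epsilon>"
proof (rule integral_abs_ball_le_if_test_le[OF _ _ r])
  have Ui: "integrable lebesgue U" and Gi: "integrable lebesgue G"
    using wd sub unfolding U G has_weak_deriv_def by (auto intro!: integrable_locally_integrable)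
  note Us = integrable_lebesgue_shift[OF Ui] and Gs = integrable_lebesgue_shift[OF Gi]
  show "integrable lebesgue (\<lambda>x. (U (x + h *\<^sub>R b) - U x) / h - G x)"
    using Ui Us Gi by auto
  fix \<phi> :: "'a \<Rightarrow> real"
  assume \<phi>: "smooth \<phi>" "\<And>x. x \<notin> cball a r \<Longrightarrow> \<phi> x = 0" "\<And>x. \<bar>\<phi> x\<bar> \<le> 1"
  have test: "\<phi> \<in> test_functions UNIV"
    by (rule test_functionsI[of \<phi> "cball a r"]) (use \<phi> in auto)
  have norm_b: "norm b = 1" using b by simp
  have \<phi>m[measurable]: "\<phi> \<in> borel_measurable lebesgue"
    by (rule test_functions_measurable[OF test])
  have sm[measurable]: "(\<lambda>x. \<phi> (x + c)) \<in> borel_measurable lebesgue" for c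
    by (rule measurable_lebesgue_shift[OF \<phi>m])
  have weak: "(LINT x|lebesgue. U x * partial_deriv b \<phi> (x + (- t) *\<^sub>R b)) = - (LINT x|lebesgue. G x * \<phi> (x + (- t) *\<^sub>R b))"
    if t: "0 \<le> t" "t \<le> h" for t
  proof -
    define \<psi> where "\<psi> x = \<phi> (x + (- t) *\<^sub>R b)" for x
    have \<psi>0: "\<psi> x = 0" if "x \<notin> cball a (2 * r)" for x
    proof -
      have "norm (x - a) \<le> norm ((x + (- t) *\<^sub>R b) - a) + norm (t *\<^sub>R b)"
        using norm_triangle_ineq[of "(x + (- t) *\<^sub>R b) - a" "t *\<^sub>R b"] by (simp add: algebra_simps)
      moreover have "norm (t *\<^sub>R b) \<le> r" using t h norm_b by simp
      moreover have "norm (x - a) > 2 * r" using that by (simp add: dist_norm norm_minus_commute)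
      ultimately have "x + (- t) *\<^sub>R b \<notin> cball a r"
        by (simp add: dist_norm norm_minus_commute)
      then show ?thesis unfolding \<psi>_def by (rule \<phi>(2))
    qed
    have \<psi>: "smooth \<psi>" "partial_deriv b \<psi> x = partial_deriv b \<phi> (x + (- t) *\<^sub>R b)" for x
      unfolding \<psi>_def by (rule smooth_shift[OF \<phi>(1)])+
    have "\<psi> \<in> test_functions \<Omega>"
      by (rule test_functionsI[OF \<psi>(1) _ sub \<psi>0]) auto
    then have "(LINT x|lebesgue_on \<Omega>. u x * partial_deriv b \<psi> x) = - (LINT x|lebesgue_on \<Omega>. g x * \<psi> x)"
      using wd unfolding has_weak_deriv_def by fastforce
    moreover have "(LINT x|lebesgue_on \<Omega>. u x * partial_deriv b \<psi> x) = (LINT x|lebesgue. U x * partial_deriv b \<psi> x)"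
      unfolding U using \<Omega> sub partial_deriv_eq_0_outside[OF closed_cball \<psi>0]
      by (intro lebesgue_on_integral_compact_support) auto
    moreover have "(LINT x|lebesgue_on \<Omega>. g x * \<psi> x) = (LINT x|lebesgue. G x * \<psi> x)"
      unfolding G using \<Omega> sub \<psi>0 by (intro lebesgue_on_integral_compact_support) auto
    ultimately show ?thesis
      by (simp only: \<psi>(2)) (simp add: \<psi>_def)
  qed
  have shift: "(LINT x|lebesgue. F x * \<phi> (x + (- t) *\<^sub>R b)) = (LINT x|lebesgue. F (x + t *\<^sub>R b) * \<phi> x)"
    if "integrable lebesgue F" for F t
  proof -
    have Fm: "F \<in> borel_measurable lebesgue" using that by auto
    show ?thesis
      using integral_lebesgue_shift[of "\<lambda>x. F x * \<phi> (x + (- t) *\<^sub>R b)" "t *\<^sub>R b"]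
        borel_measurable_times[OF Fm sm, of "(- t) *\<^sub>R b"] by simp
  qed
  define A where "A t = (LINT x|lebesgue. U x * \<phi> (x + (- t) *\<^sub>R b))" for t
  define B where "B t = (LINT x|lebesgue. G (x + t *\<^sub>R b) * \<phi> x)" for t
  have der: "(A has_real_derivative B t) (at t)" if t: "0 \<le> t" "t \<le> h" for t
  proof -
    have "((\<lambda>t. LINT x|lebesgue. U x * \<phi> (x + (- t) *\<^sub>R b)) has_real_derivative
      (LINT x|lebesgue. U x * partial_deriv b \<phi> (x + (- t) *\<^sub>R b)) * (- 1)) (at t)"
      by (rule DERIV_chain2[OF has_real_derivative_integral_translate[OF Ui test b]])
         (auto intro!: derivative_eq_intros)
    then show ?thesis
      using weak[OF t] shift[OF Gi] unfolding A_def B_def by simp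
  qed
  obtain t where t: "0 < t" "t < h" and At: "A h - A 0 = h * B t"
    using MVT2[of 0 h A B] h der by auto
  have i1: "integrable lebesgue (\<lambda>x. F x * \<phi> x)" if "integrable lebesgue F" for F
    by (rule integrable_mult_bounded[OF that \<phi>m \<phi>(3)])
  have "(LINT x|lebesgue. ((U (x + h *\<^sub>R b) - U x) / h - G x) * \<phi> x)
      = ((LINT x|lebesgue. U (x + h *\<^sub>R b) * \<phi> x) - (LINT x|lebesgue. U x * \<phi> x)) / h - (LINT x|lebesgue. G x * \<phi> x)"
  proof -
    have "((U (x + h *\<^sub>R b) - U x) / h - G x) * \<phi> x = (U (x + h *\<^sub>R b) * \<phi> x - U x * \<phi> x) / h - G x * \<phi> x" for x
      by (simp add: algebra_simps)
    then show ?thesis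
      using i1[OF Us] i1[OF Ui] i1[OF Gi] by simp
  qed
  also have "\<dots> = (A h - A 0) / h - B 0"
    using shift[OF Ui, of h] unfolding A_def B_def by simp
  also have "\<dots> = B t - B 0"
    using At h by simp
  also have "\<dots> = (LINT x|lebesgue. (G (x + t *\<^sub>R b) - G x) * \<phi> x)"
    unfolding B_def using i1[OF Gs] i1[OF Gi] by (simp add: left_diff_distrib)
  also have "\<bar>\<dots>\<bar> \<le> (LINT x|lebesgue. \<bar>(G (x + t *\<^sub>R b) - G x) * \<phi> x\<bar>)"
    by (rule integral_abs_bound)
  also have "\<dots> \<le> (LINT x|lebesgue. \<bar>G (x + t *\<^sub>R b) - G x\<bar>)"
    by (rule integral_mono[OF integrable_abs[OF i1[OF Bochner_Integration.integrable_diff[OF Gs Gi]]]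
          integrable_abs[OF Bochner_Integration.integrable_diff[OF Gs Gi]]])
      (simp add: abs_mult mult_left_le \<phi>(3))
  also have "\<dots> \<le> \<epsilon>"
    by (rule le[OF t])
  finally show "\<bar>LINT x|lebesgue. ((U (x + h *\<^sub>R b) - U x) / h - G x) * \<phi> x\<bar> \<le> \<epsilon>" .
qed

text \<open>
  Let \<open>F\<close> be \<open>|G|\<close> restricted to the zeros of \<open>U\<close> in the ball. At such a zero \<open>x\<close> there are two cases. If
  \<open>x + hb\<close> is a zero as well, then the difference quotient vanishes at \<open>x\<close> and \<open>F x\<close> is its distance
  to \<open>G\<close>. Otherwise \<open>F (x + hb) = 0\<close> and \<open>F x\<close> is the distance of \<open>F\<close> to its translate. Both distances
  tend to zero in \<open>L1\<close> as \<open>h\<close> does, so \<open>F\<close> has integral zero.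
\<close>

lemma weak_deriv_eq_0_on_zeros_ball:
  fixes u g :: "'a::euclidean_space \<Rightarrow> real"
  assumes \<Omega>: "open \<Omega>" and b: "b \<in> Basis" and wd: "has_weak_deriv \<Omega> [b] u g"
    and r: "r > 0" and sub: "cball a (2 * r) \<subseteq> \<Omega>"
  shows "AE x in lebesgue. x \<in> ball a r \<longrightarrow> u x = 0 \<longrightarrow> g x = 0"
proof -
  define U where "U = (\<lambda>x. indicator (cball a (2 * r)) x * u x)"
  define G where "G = (\<lambda>x. indicator (cball a (2 * r)) x * g x)"
  have Ui: "integrable lebesgue U" and Gi: "integrable lebesgue G"
    using wd sub unfolding U_def G_def has_weak_deriv_def by (auto intro!: integrable_locally_integrable)
  have Um[measurable]: "U \<in> borel_measurable lebesgue" using Ui by auto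
  define Z where "Z = ball a r \<inter> {x. U x = 0}"
  have Z: "Z \<in> sets lebesgue"
  proof -
    have "{x \<in> space lebesgue. U x = 0} \<in> sets lebesgue" by measurable
    then show ?thesis unfolding Z_def by (intro sets.Int) auto
  qed
  define F where "F x = indicator Z x * \<bar>G x\<bar>" for x
  have Fi: "integrable lebesgue F"
    unfolding F_def using Gi Z by (intro integrable_indicator_mult) auto
  have F0: "F x \<ge> 0" for x by (simp add: F_def)
  have "(LINT x|lebesgue. F x) \<le> 0"
  proof (rule field_le_epsilon)
    fix e :: real assume e: "e > 0"
    obtain d1 where d1: "d1 > 0" "\<And>c. norm c < d1 \<Longrightarrow> (LINT x|lebesgue. \<bar>G (x + c) - G x\<bar>) < e/2"
      using L1_translation_continuous[OF Gi, of "e/2"] e by auto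
    obtain d2 where d2: "d2 > 0" "\<And>c. norm c < d2 \<Longrightarrow> (LINT x|lebesgue. \<bar>F (x + c) - F x\<bar>) < e/2"
      using L1_translation_continuous[OF Fi, of "e/2"] e by auto
    define h where "h = min r (min d1 d2 / 2)"
    have h: "0 < h" "h \<le> r" "h < d1" "h < d2"
      using d1 d2 r by (auto simp: h_def)
    let ?Q = "\<lambda>x. indicator (ball a r) x * \<bar>(U (x + h *\<^sub>R b) - U x) / h - G x\<bar>"
    have Q: "(LINT x|lebesgue. ?Q x) \<le> e/2"
      using d1 h b by (intro weak_deriv_diff_quotient_le[OF \<Omega> b wd r sub h(1,2) U_def G_def] less_imp_le[OF d1(2)]) auto
    have T: "(LINT x|lebesgue. \<bar>F (x + h *\<^sub>R b) - F x\<bar>) < e/2"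
      using h b by (intro d2) auto
    have Qi: "integrable lebesgue ?Q"
      using Ui Gi integrable_lebesgue_shift[OF Ui, of "h *\<^sub>R b"] by (intro integrable_indicator_mult) auto
    have Ti: "integrable lebesgue (\<lambda>x. \<bar>F (x + h *\<^sub>R b) - F x\<bar>)"
      using Fi integrable_lebesgue_shift[OF Fi] by auto
    have "F x \<le> ?Q x + \<bar>F (x + h *\<^sub>R b) - F x\<bar>" for x
    proof (cases "x \<in> Z")
      case True
      then have x: "x \<in> ball a r" "U x = 0" by (auto simp: Z_def)
      show ?thesis
      proof (cases "U (x + h *\<^sub>R b) = 0")
        case True
        then show ?thesis using x by (simp add: F_def indicator_def)
      next
        case False
        then have "F (x + h *\<^sub>R b) = 0" by (simp add: F_def Z_def)
        then show ?thesis using F0[of x] by simp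
      qed
    qed (simp add: F_def)
    then have "(LINT x|lebesgue. F x) \<le> (LINT x|lebesgue. ?Q x + \<bar>F (x + h *\<^sub>R b) - F x\<bar>)"
      using Qi Ti by (intro integral_mono Fi) auto
    also have "\<dots> = (LINT x|lebesgue. ?Q x) + (LINT x|lebesgue. \<bar>F (x + h *\<^sub>R b) - F x\<bar>)"
      by (rule Bochner_Integration.integral_add[OF Qi Ti])
    finally show "(LINT x|lebesgue. F x) \<le> 0 + e"
      using Q T by simp
  qed
  moreover have "(LINT x|lebesgue. F x) \<ge> 0"
    using F0 by (intro integral_nonneg_AE) auto
  ultimately have "(LINT x|lebesgue. F x) = 0" by simp
  then have "AE x in lebesgue. F x = 0"
    using integral_nonneg_eq_0_iff_AE[OF Fi] F0 by simp
  then show ?thesis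
  proof eventually_elim
    case (elim x)
    show ?case
    proof (intro impI)
      assume x: "x \<in> ball a r" "u x = 0"
      then have "x \<in> cball a (2 * r)" using r by auto
      then show "g x = 0" using x elim by (simp add: F_def Z_def U_def G_def)
    qed
  qed
qed

lemma weak_deriv_eq_0_on_zeros:
  fixes u g :: "'a::euclidean_space \<Rightarrow> real"
  assumes "open \<Omega>" "b \<in> Basis" "has_weak_deriv \<Omega> [b] u g"
  shows "AE x in lebesgue. x \<in> \<Omega> \<longrightarrow> u x = 0 \<longrightarrow> g x = 0"
  by (rule AE_open_if_AE_balls[OF assms(1)]) (rule weak_deriv_eq_0_on_zeros_ball[OF assms])


section \<open>Weak derivatives\<close>

lemma AE_lebesgue_on_iff:
  "\<Omega> \<in> sets lebesgue \<Longrightarrow> (AE x in lebesgue_on \<Omega>. P x) \<longleftrightarrow> (AE x in lebesgue. x \<in> \<Omega> \<longrightarrow> P x)"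
  by (rule AE_restrict_space_iff) simp

lemma AE_negligible:
  fixes P :: "'a::euclidean_space \<Rightarrow> bool"
  assumes "AE x in lebesgue. P x"
  obtains N where "negligible N" "\<And>x. x \<notin> N \<Longrightarrow> P x"
proof -
  obtain N where "\<And>x. x \<in> space lebesgue - N \<Longrightarrow> P x" "N \<in> null_sets lebesgue"
    by (rule AE_E3[OF assms]) blast
  then show thesis
    using that[of N] by (simp add: negligible_iff_null_sets)
qed

lemma measurable_lebesgue_on_AE_cong:
  fixes f g :: "'a::euclidean_space \<Rightarrow> real"
  assumes "f \<in> borel_measurable (lebesgue_on \<Omega>)" "AE x in lebesgue. x \<in> \<Omega> \<longrightarrow> g x = f x" "\<Omega> \<in> sets lebesgue"
  shows "g \<in> borel_measurable (lebesgue_on \<Omega>)"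
proof -
  obtain N where N: "negligible N" "\<And>x. x \<notin> N \<Longrightarrow> x \<in> \<Omega> \<longrightarrow> g x = f x"
    using AE_negligible[OF assms(2)] by blast
  have "f measurable_on \<Omega>"
    using assms by (simp add: measurable_on_iff_borel_measurable)
  then have "g measurable_on \<Omega>"
    by (rule measurable_on_spike[OF _ N(1)]) (use N(2) in auto)
  then show ?thesis
    using assms by (simp add: measurable_on_iff_borel_measurable)
qed

lemma locally_integrable_AE_cong:
  fixes f g :: "'a::euclidean_space \<Rightarrow> real"
  assumes "f locally_integrable_on \<Omega>" "AE x in lebesgue. x \<in> \<Omega> \<longrightarrow> g x = f x"
  shows "g locally_integrable_on \<Omega>"
proof -
  obtain N where N: "negligible N" "\<And>x. x \<notin> N \<Longrightarrow> x \<in> \<Omega> \<longrightarrow> g x = f x"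
    using AE_negligible[OF assms(2)] by blast
  show ?thesis
    unfolding locally_integrable_on_def
  proof (intro allI impI)
    fix K assume K: "compact K \<and> K \<subseteq> \<Omega>"
    then have "f absolutely_integrable_on K"
      using assms(1) unfolding locally_integrable_on_def by blast
    then show "g absolutely_integrable_on K"
      by (rule absolutely_integrable_spike[OF _ N(1)]) (use N(2) K in auto)
  qed
qed

lemma locally_integrable_mono:
  "f locally_integrable_on \<Omega> \<Longrightarrow> V \<subseteq> \<Omega> \<Longrightarrow> f locally_integrable_on V"
  unfolding locally_integrable_on_def by blast

lemma locally_integrable_diff:
  "f locally_integrable_on \<Omega> \<Longrightarrow> g locally_integrable_on \<Omega> \<Longrightarrow> (\<lambda>x. f x - g x) locally_integrable_on \<Omega>"
  unfolding locally_integrable_on_def by (auto intro: set_integral_diff)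

lemma integrable_mult_test_function:
  fixes u \<phi> :: "'a::euclidean_space \<Rightarrow> real"
  assumes \<Omega>: "\<Omega> \<in> sets lebesgue" and u: "u locally_integrable_on \<Omega>" and \<phi>: "\<phi> \<in> test_functions \<Omega>"
  shows "integrable (lebesgue_on \<Omega>) (\<lambda>x. u x * \<phi> x)"
proof -
  obtain K where K: "smooth \<phi>" "compact K" "K \<subseteq> \<Omega>" "\<And>x. x \<notin> K \<Longrightarrow> \<phi> x = 0"
    using test_functionsE[OF \<phi>] by blast
  obtain M where M: "\<And>x. \<bar>\<phi> x\<bar> \<le> M" using test_functions_bounded[OF \<phi>] by blast
  have "integrable lebesgue (\<lambda>x. (indicator K x * u x) * \<phi> x)"
    by (rule integrable_mult_bounded[OF integrable_locally_integrable[OF u K(2,3)] test_functions_measurable[OF \<phi>] M])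
  moreover have "(indicator K x * u x) * \<phi> x = indicator \<Omega> x *\<^sub>R (u x * \<phi> x)" for x
    using K by (cases "x \<in> K") (auto simp: indicator_def)
  ultimately show ?thesis
    using \<Omega> by (simp only:) (simp add: integrable_restrict_space)
qed

lemma lebesgue_on_integral_eq_if_compact_support:
  fixes u f :: "'a::euclidean_space \<Rightarrow> real"
  assumes "\<Omega> \<in> sets lebesgue" "V \<in> sets lebesgue" "K \<subseteq> \<Omega>" "K \<subseteq> V" "\<And>x. x \<notin> K \<Longrightarrow> f x = 0"
  shows "(LINT x|lebesgue_on \<Omega>. u x * f x) = (LINT x|lebesgue_on V. u x * f x)"
  using lebesgue_on_integral_compact_support[of \<Omega> K f u] lebesgue_on_integral_compact_support[of V K f u] assms by simp

lemma iter_partial_eq_0_outside: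
  assumes "closed K" "\<And>x. x \<notin> K \<Longrightarrow> f x = 0" "x \<notin> K"
  shows "iter_partial bs f x = 0"
  using assms(3) by (induction bs arbitrary: x) (auto simp: assms(2) intro: partial_deriv_eq_0_outside[OF assms(1)])

lemma has_weak_deriv_unique:
  assumes \<Omega>: "open \<Omega>" and g: "has_weak_deriv \<Omega> bs u g" and g': "has_weak_deriv \<Omega> bs u g'"
  shows "AE x in lebesgue. x \<in> \<Omega> \<longrightarrow> g x = g' x"
proof -
  have \<Omega>s: "\<Omega> \<in> sets lebesgue" using \<Omega> by simp
  have gl: "g locally_integrable_on \<Omega>" "g' locally_integrable_on \<Omega>"
    using g g' by (auto simp: has_weak_deriv_def)
  have "AE x in lebesgue. x \<in> \<Omega> \<longrightarrow> g x - g' x = 0"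
  proof (rule AE_eq_0_if_test_integrals_0[OF \<Omega> locally_integrable_diff[OF gl]])
    fix \<phi> assume \<phi>: "\<phi> \<in> test_functions \<Omega>"
    have "(LINT x|lebesgue_on \<Omega>. g x * \<phi> x) = (LINT x|lebesgue_on \<Omega>. g' x * \<phi> x)"
      using g g' \<phi> unfolding has_weak_deriv_def by fastforce
    then show "(LINT x|lebesgue_on \<Omega>. (g x - g' x) * \<phi> x) = 0"
      using integrable_mult_test_function[OF \<Omega>s gl(1) \<phi>] integrable_mult_test_function[OF \<Omega>s gl(2) \<phi>]
      by (simp add: left_diff_distrib)
  qed
  then show ?thesis by simp
qed

lemma has_weak_deriv_weak_deriv:
  "has_weak_deriv \<Omega> bs u g \<Longrightarrow> has_weak_deriv \<Omega> bs u (weak_deriv \<Omega> bs u)"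
  unfolding weak_deriv_def by (rule someI[of "has_weak_deriv \<Omega> bs u"])

lemma weak_deriv_AE_eq:
  assumes "open \<Omega>" "has_weak_deriv \<Omega> bs u g"
  shows "AE x in lebesgue. x \<in> \<Omega> \<longrightarrow> weak_deriv \<Omega> bs u x = g x"
  by (rule has_weak_deriv_unique[OF assms(1) has_weak_deriv_weak_deriv[OF assms(2)] assms(2)])

lemma has_weak_deriv_diff:
  assumes \<Omega>: "\<Omega> \<in> sets lebesgue" and bs: "bs \<in> lists Basis"
    and f: "has_weak_deriv \<Omega> bs u f" and g: "has_weak_deriv \<Omega> bs v g"
  shows "has_weak_deriv \<Omega> bs (\<lambda>x. u x - v x) (\<lambda>x. f x - g x)"
proof -
  have l: "u locally_integrable_on \<Omega>" "v locally_integrable_on \<Omega>" "f locally_integrable_on \<Omega>" "g locally_integrable_on \<Omega>"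
    using f g by (auto simp: has_weak_deriv_def)
  note i = integrable_mult_test_function[OF \<Omega>]
  have "(LINT x|lebesgue_on \<Omega>. (u x - v x) * iter_partial bs \<phi> x) = (- 1) ^ length bs * (LINT x|lebesgue_on \<Omega>. (f x - g x) * \<phi> x)"
    if \<phi>: "\<phi> \<in> test_functions \<Omega>" for \<phi>
  proof -
    have \<phi>': "iter_partial bs \<phi> \<in> test_functions \<Omega>"
      by (rule test_functions_iter_partial[OF \<phi> bs])
    have "(LINT x|lebesgue_on \<Omega>. (u x - v x) * iter_partial bs \<phi> x) = 
       (LINT x|lebesgue_on \<Omega>. u x * iter_partial bs \<phi> x) - (LINT x|lebesgue_on \<Omega>. v x * iter_partial bs \<phi> x)"
      using i[OF l(1) \<phi>'] i[OF l(2) \<phi>'] by (simp add: left_diff_distrib)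
    also have "\<dots> = (- 1) ^ length bs * (LINT x|lebesgue_on \<Omega>. f x * \<phi> x) - (- 1) ^ length bs * (LINT x|lebesgue_on \<Omega>. g x * \<phi> x)"
      using f g \<phi> by (simp add: has_weak_deriv_def)
    also have "\<dots> = (- 1) ^ length bs * (LINT x|lebesgue_on \<Omega>. (f x - g x) * \<phi> x)"
      using i[OF l(3) \<phi>] i[OF l(4) \<phi>] by (simp add: left_diff_distrib right_diff_distrib)
    finally show ?thesis .
  qed
  then show ?thesis
    using l by (simp add: has_weak_deriv_def locally_integrable_diff)
qed

lemma has_weak_deriv_subset:
  assumes wd: "has_weak_deriv \<Omega> bs u g" and s: "\<Omega> \<in> sets lebesgue" "V \<in> sets lebesgue" and sub: "V \<subseteq> \<Omega>"
  shows "has_weak_deriv V bs u g"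
proof -
  have "(LINT x|lebesgue_on V. u x * iter_partial bs \<phi> x) = (- 1) ^ length bs * (LINT x|lebesgue_on V. g x * \<phi> x)"
    if \<phi>: "\<phi> \<in> test_functions V" for \<phi>
  proof -
    obtain K where K: "smooth \<phi>" "compact K" "K \<subseteq> V" "\<And>x. x \<notin> K \<Longrightarrow> \<phi> x = 0"
      using test_functionsE[OF \<phi>] by blast
    have "(LINT x|lebesgue_on \<Omega>. u x * iter_partial bs \<phi> x) = (- 1) ^ length bs * (LINT x|lebesgue_on \<Omega>. g x * \<phi> x)"
      using wd test_functions_mono[OF sub \<phi>] by (simp add: has_weak_deriv_def)
    moreover have "(LINT x|lebesgue_on \<Omega>. g x * \<phi> x) = (LINT x|lebesgue_on V. g x * \<phi> x)"
      using K sub s by (intro lebesgue_on_integral_eq_if_compact_support[of _ _ K]) auto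
    moreover have "(LINT x|lebesgue_on \<Omega>. u x * iter_partial bs \<phi> x) = (LINT x|lebesgue_on V. u x * iter_partial bs \<phi> x)"
      using K sub s iter_partial_eq_0_outside[OF compact_imp_closed[OF K(2)] K(4)]
      by (intro lebesgue_on_integral_eq_if_compact_support[of _ _ K]) auto
    ultimately show ?thesis by simp
  qed
  then show ?thesis
    using wd locally_integrable_mono[OF _ sub] by (auto simp: has_weak_deriv_def)
qed

text \<open>
  Weak derivatives on an exhaustion by balls agree almost everywhere on overlaps, hence glue to one on the
  whole space. At \<open>x\<close> the glued function takes its value from the ball of index \<open>\<lceil>norm x\<rceil>\<close>, which
  contains \<open>x\<close> because its radius is larger by one.
\<close>

lemma has_weak_deriv_UNIV_if_balls:
  fixes u :: "'a::euclidean_space \<Rightarrow> real" and g :: "nat \<Rightarrow> 'a \<Rightarrow> real"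
  assumes wd: "\<And>k::nat. has_weak_deriv (ball 0 (real (Suc k))) bs u (g k)"
  shows "\<exists>G. has_weak_deriv UNIV bs u G"
proof -
  define V where "V k = ball (0::'a) (real (Suc k))" for k
  define m where "m x = nat \<lceil>norm x\<rceil>" for x :: 'a
  have mV: "x \<in> V (m x)" for x
    unfolding V_def m_def by (simp add: of_nat_nat) linarith
  define G where "G x = g (m x) x" for x
  have Vmono: "V j \<subseteq> V k" if "j \<le> k" for j k
    using that by (auto simp: V_def)
  have agree: "AE x in lebesgue. x \<in> V (min j k) \<longrightarrow> g j x = g k x" for j k
  proof (rule has_weak_deriv_unique)
    have Vs: "V i \<in> sets lebesgue" for i by (simp add: V_def)
    show "has_weak_deriv (V (min j k)) bs u (g j)"
      by (rule has_weak_deriv_subset[OF wd[folded V_def, of j] Vs Vs Vmono]) simp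
    show "has_weak_deriv (V (min j k)) bs u (g k)"
      by (rule has_weak_deriv_subset[OF wd[folded V_def, of k] Vs Vs Vmono]) simp
  qed (simp add: V_def)
  then have "AE x in lebesgue. \<forall>j k. x \<in> V (min j k) \<longrightarrow> g j x = g k x"
    by (simp add: AE_all_countable)
  then have eq: "AE x in lebesgue. x \<in> V k \<longrightarrow> G x = g k x" for k
  proof eventually_elim
    case (elim x)
    have "x \<in> V (min (m x) k)" if "x \<in> V k"
      using that mV[of x] by (simp add: min_def)
    then show ?case using elim by (auto simp: G_def)
  qed
  have compact_sub: "\<exists>k. K \<subseteq> V k" if K: "compact K" for K
  proof -
    obtain B where B: "\<And>x. x \<in> K \<Longrightarrow> norm x \<le> B"
      using compact_imp_bounded[OF K] bounded_iff by blast
    have "K \<subseteq> V (nat \<lceil>B\<rceil>)"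
    proof
      fix x assume "x \<in> K"
      then have "norm x \<le> B" by (rule B)
      also have "B \<le> real (nat \<lceil>B\<rceil>)" by (rule real_nat_ceiling_ge)
      finally show "x \<in> V (nat \<lceil>B\<rceil>)" by (simp add: V_def)
    qed
    then show ?thesis by blast
  qed
  have Gl: "G locally_integrable_on V k" for k
    using locally_integrable_AE_cong[OF _ eq, of k] wd[of k] by (simp add: has_weak_deriv_def V_def)
  have "has_weak_deriv UNIV bs u G"
    unfolding has_weak_deriv_def
  proof (intro conjI ballI)
    show "u locally_integrable_on UNIV" "G locally_integrable_on UNIV"
      unfolding locally_integrable_on_def
      using compact_sub Gl wd unfolding has_weak_deriv_def locally_integrable_on_def V_def by metis+
    fix \<phi> :: "'a \<Rightarrow> real" assume "\<phi> \<in> test_functions UNIV"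
    then obtain K where K: "smooth \<phi>" "compact K" "K \<subseteq> UNIV" "\<And>x. x \<notin> K \<Longrightarrow> \<phi> x = 0"
      using test_functionsE[of \<phi> UNIV] by blast
    obtain k where k: "K \<subseteq> V k" using compact_sub[OF K(2)] by blast
    have Vs: "V k \<in> sets lebesgue" by (simp add: V_def)
    have \<phi>: "\<phi> \<in> test_functions (V k)"
      by (rule test_functionsI[OF K(1,2) k K(4)])
    have gl: "g k locally_integrable_on V k"
      using wd[of k] by (simp add: has_weak_deriv_def V_def)
    have 1: "(LINT x|lebesgue_on UNIV. u x * iter_partial bs \<phi> x) = (LINT x|lebesgue_on (V k). u x * iter_partial bs \<phi> x)"
      using k Vs iter_partial_eq_0_outside[OF compact_imp_closed[OF K(2)] K(4)]
      by (intro lebesgue_on_integral_eq_if_compact_support[of _ _ K]) auto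
    have 2: "(LINT x|lebesgue_on UNIV. G x * \<phi> x) = (LINT x|lebesgue_on (V k). G x * \<phi> x)"
      using k Vs K(4) by (intro lebesgue_on_integral_eq_if_compact_support[of _ _ K]) auto
    have 3: "(LINT x|lebesgue_on (V k). G x * \<phi> x) = (LINT x|lebesgue_on (V k). g k x * \<phi> x)"
    proof (rule integral_cong_AE)
      show "AE x in lebesgue_on (V k). G x * \<phi> x = g k x * \<phi> x"
        unfolding AE_lebesgue_on_iff[OF Vs] using eq[of k] by eventually_elim auto
    qed (use integrable_mult_test_function[OF Vs Gl \<phi>] integrable_mult_test_function[OF Vs gl \<phi>] in auto)
    show "(LINT x|lebesgue_on UNIV. u x * iter_partial bs \<phi> x) = (- 1) ^ length bs * (LINT x|lebesgue_on UNIV. G x * \<phi> x)"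
      unfolding 1 2 3 using wd[of k] \<phi> by (simp add: has_weak_deriv_def V_def)
  qed
  then show ?thesis by blast
qed

section \<open>Integration by parts for test functions\<close>

text \<open>
  Again the set for \<open>smooth_coinduct\<close>: sums of products are stable under partial derivatives.
\<close>

inductive_set smooth_products :: "('a::euclidean_space \<Rightarrow> real) set" where
  base: "smooth f \<Longrightarrow> smooth g \<Longrightarrow> (\<lambda>x. f x * g x) \<in> smooth_products"
| add: "f \<in> smooth_products \<Longrightarrow> g \<in> smooth_products \<Longrightarrow> (\<lambda>x. f x + g x) \<in> smooth_products"

lemma smooth_products_closed:
  assumes "f \<in> smooth_products" and b: "b \<in> Basis"
  shows "(\<forall>x. f differentiable (at x)) \<and> partial_deriv b f \<in> smooth_products"
  using assms(1)
proof induction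
  case (base f g)
  note d = smooth_imp_differentiable[OF base(1)] smooth_imp_differentiable[OF base(2)]
  have "partial_deriv b (\<lambda>x. f x * g x) = (\<lambda>x. f x * partial_deriv b g x + partial_deriv b f x * g x)"
    by (intro ext partial_deriv_mult d)
  moreover have "\<dots> \<in> smooth_products"
    by (intro smooth_products.add smooth_products.base base smooth_partial_deriv b)
  ultimately show ?case
    using differentiable_mult[OF d] by simp
next
  case (add f g)
  have "partial_deriv b (\<lambda>x. f x + g x) = (\<lambda>x. partial_deriv b f x + partial_deriv b g x)"
    using add.IH by (intro ext partial_deriv_add) blast+
  then show ?case
    using add.IH by (simp add: smooth_products.add differentiable_add)
qed

lemma smooth_mult:
  assumes "smooth f" "smooth g"
  shows "smooth (\<lambda>x. f x * g x)"
proof (rule smooth_coinduct[where S=smooth_products])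
  show "h differentiable_on UNIV" if "h \<in> smooth_products" for h :: "'a \<Rightarrow> real"
    using smooth_products_closed[OF that SOME_Basis] by (simp add: differentiable_on_def)
qed (use assms smooth_products_closed in \<open>auto intro: smooth_products.base\<close>)

lemma integrable_test_function:
  assumes "\<phi> \<in> test_functions \<Omega>"
  shows "integrable lebesgue \<phi>"
proof -
  have "(\<lambda>x. 1::real) locally_integrable_on (UNIV :: 'a set)"
    unfolding locally_integrable_on_def set_integrable_def
    using emeasure_compact_finite by (auto intro!: integrable_real_indicator simp: compact_imp_closed less_top)
  then have "integrable (lebesgue_on UNIV) (\<lambda>x. 1 * \<phi> x)"
    using test_functions_mono[OF subset_UNIV assms] by (intro integrable_mult_test_function) auto
  then show ?thesis by (simp add: lebesgue_on_UNIV_eq)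
qed

text \<open>
  The integral of a translate \<open>f(x + tb)\<close> does not depend on \<open>t\<close>, and its derivative at \<open>t = 0\<close> is the
  integral of the partial derivative. The factor \<open>?u\<close> only serves to replace the constant 1, which is not
  integrable; for \<open>|t| < 1\<close> the translates are supported where it is 1.
\<close>

lemma integral_partial_deriv_test_function:
  fixes f :: "'a::euclidean_space \<Rightarrow> real"
  assumes f: "f \<in> test_functions UNIV" and b: "b \<in> Basis"
  shows "(LINT x|lebesgue. partial_deriv b f x) = 0"
proof -
  obtain K where "smooth f" and K: "compact K" "K \<subseteq> UNIV" "\<And>x. x \<notin> K \<Longrightarrow> f x = 0"
    using test_functionsE[OF f] by blast
  obtain R where R: "\<And>x. x \<in> K \<Longrightarrow> norm x \<le> R" "R > 0"
    using compact_imp_bounded[OF K(1)] bounded_pos by blast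
  let ?u = "indicator (cball 0 (R + 1)) :: 'a \<Rightarrow> real"
  have u: "integrable lebesgue ?u"
    by (intro integrable_real_indicator) (use emeasure_lborel_cball_finite in \<open>auto simp: less_top\<close>)
  have near: "?u x * h (x + t *\<^sub>R b) = h (x + t *\<^sub>R b)" if "\<bar>t\<bar> < 1" "\<And>x. x \<notin> K \<Longrightarrow> h x = 0" for h t and x :: 'a
  proof (cases "norm x \<le> R + 1")
    case False
    have "norm (t *\<^sub>R b) < 1" using that b by simp
    then have "norm (x + t *\<^sub>R b) > R"
      using False norm_triangle_ineq4[of "x + t *\<^sub>R b" "t *\<^sub>R b"] by simp
    then show ?thesis using R(1) that(2) by fastforce
  qed simp
  have df: "partial_deriv b f x = 0" if "x \<notin> K" for x
    by (rule partial_deriv_eq_0_outside[OF compact_imp_closed[OF K(1)] K(3) that])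
  have fm: "f \<in> borel_measurable lebesgue" by (rule test_functions_measurable[OF f])
  have "((\<lambda>t. LINT x|lebesgue. ?u x * f (x + t *\<^sub>R b)) has_real_derivative
      (LINT x|lebesgue. ?u x * partial_deriv b f (x + 0 *\<^sub>R b))) (at 0)"
    by (rule has_real_derivative_integral_translate[OF u f b])
  moreover have "((\<lambda>t. LINT x|lebesgue. ?u x * f (x + t *\<^sub>R b)) has_real_derivative 0) (at 0)"
  proof (rule has_field_derivative_transform_within_open[of "\<lambda>t. LINT x|lebesgue. f x" _ _ "ball 0 1"])
    fix t :: real assume "t \<in> ball 0 1"
    then have "\<bar>t\<bar> < 1" by simp
    then have "?u x * f (x + t *\<^sub>R b) = f (x + t *\<^sub>R b)" for x
      by (rule near) (rule K(3))
    then show "(LINT x|lebesgue. f x) = (LINT x|lebesgue. ?u x * f (x + t *\<^sub>R b))"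
      by (simp only: integral_lebesgue_shift[OF fm])
  qed auto
  ultimately have "(LINT x|lebesgue. ?u x * partial_deriv b f (x + 0 *\<^sub>R b)) = 0"
    by (rule DERIV_unique)
  moreover have "?u x * partial_deriv b f (x + 0 *\<^sub>R b) = partial_deriv b f (x + 0 *\<^sub>R b)" for x
    by (rule near) (simp_all add: df)
  ultimately show ?thesis
    by (simp only: scaleR_zero_left add_0_right)
qed

lemma integral_by_parts_test_functions:
  fixes f g :: "'a::euclidean_space \<Rightarrow> real"
  assumes f: "f \<in> test_functions UNIV" and g: "g \<in> test_functions UNIV" and b: "b \<in> Basis"
  shows "(LINT x|lebesgue. f x * partial_deriv b g x) = - (LINT x|lebesgue. partial_deriv b f x * g x)"
proof -
  have s: "smooth f" "smooth g" using f g by (auto simp: test_functions_def)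
  obtain K where "smooth f" and K: "compact K" "K \<subseteq> UNIV" "\<And>x. x \<notin> K \<Longrightarrow> f x = 0"
    using test_functionsE[OF f] by blast
  have fg: "(\<lambda>x. f x * g x) \<in> test_functions UNIV"
    by (rule test_functionsI[OF smooth_mult[OF s] K(1)]) (use K(3) in auto)
  have i: "integrable lebesgue (\<lambda>x. p x * q x)" if p: "p \<in> test_functions UNIV" and q: "q \<in> test_functions UNIV" 
    for p q :: "'a \<Rightarrow> real"
  proof -
    obtain M where M: "\<And>x. \<bar>q x\<bar> \<le> M" using test_functions_bounded[OF q] by blast
    show ?thesis
      by (rule integrable_mult_bounded[OF integrable_test_function[OF p] test_functions_measurable[OF q] M])
  qed
  have "partial_deriv b (\<lambda>x. f x * g x) = (\<lambda>x. f x * partial_deriv b g x + partial_deriv b f x * g x)"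
    by (intro ext partial_deriv_mult smooth_imp_differentiable s)
  then have "(LINT x|lebesgue. f x * partial_deriv b g x + partial_deriv b f x * g x) = 0"
    using integral_partial_deriv_test_function[OF fg b] by simp
  then show ?thesis
    using i[OF f test_functions_partial_deriv[OF g b]] i[OF test_functions_partial_deriv[OF f b] g] by simp
qed

lemma has_weak_deriv_test_function:
  fixes f :: "'a::euclidean_space \<Rightarrow> real"
  assumes \<Omega>: "open \<Omega>" and f: "f \<in> test_functions UNIV" and b: "b \<in> Basis"
  shows "has_weak_deriv \<Omega> [b, b] f (iter_partial [b, b] f)"
proof -
  have l: "h locally_integrable_on \<Omega>" if "h \<in> test_functions UNIV" for h :: "'a \<Rightarrow> real"
    unfolding locally_integrable_on_def set_integrable_def
    using integrable_test_function[OF that] by (auto intro!: integrable_indicator_mult simp: compact_imp_closed)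
  note d = test_functions_partial_deriv[OF _ b]
  have "(LINT x|lebesgue_on \<Omega>. f x * iter_partial [b, b] \<psi> x) = (- 1) ^ length [b, b] * (LINT x|lebesgue_on \<Omega>. iter_partial [b, b] f x * \<psi> x)"
    if \<psi>: "\<psi> \<in> test_functions \<Omega>" for \<psi>
  proof -
    have \<psi>U: "\<psi> \<in> test_functions UNIV" by (rule test_functions_mono[OF subset_UNIV \<psi>])
    obtain K where K: "smooth \<psi>" "compact K" "K \<subseteq> \<Omega>" "\<And>x. x \<notin> K \<Longrightarrow> \<psi> x = 0"
      using test_functionsE[OF \<psi>] by blast
    have e: "(LINT x|lebesgue_on \<Omega>. p x * q x) = (LINT x|lebesgue. p x * q x)" if "\<And>x. x \<notin> K \<Longrightarrow> q x = 0" for p q :: "'a \<Rightarrow> real"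
      using lebesgue_on_integral_eq_if_compact_support[of \<Omega> UNIV K q p] \<Omega> K(3) that by (simp add: lebesgue_on_UNIV_eq)
    have "(LINT x|lebesgue_on \<Omega>. f x * iter_partial [b, b] \<psi> x) = (LINT x|lebesgue. f x * iter_partial [b, b] \<psi> x)"
      by (rule e, rule iter_partial_eq_0_outside[OF compact_imp_closed[OF K(2)] K(4)])
    also have "\<dots> = (LINT x|lebesgue. iter_partial [b, b] f x * \<psi> x)"
      using integral_by_parts_test_functions[OF f d[OF \<psi>U] b] integral_by_parts_test_functions[OF d[OF f] \<psi>U b] by simp
    also have "\<dots> = (LINT x|lebesgue_on \<Omega>. iter_partial [b, b] f x * \<psi> x)"
      by (rule e[symmetric], rule K(4))
    finally show ?thesis by simp
  qed
  then show ?thesis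
    using l[OF f] l[OF d[OF d[OF f]]] by (simp add: has_weak_deriv_def)
qed

section \<open>Square-integrable functions\<close>

lemma L2_measurable: "f \<in> L2 \<Omega> \<Longrightarrow> f \<in> borel_measurable (lebesgue_on \<Omega>)"
  and L2_square_integrable: "f \<in> L2 \<Omega> \<Longrightarrow> integrable (lebesgue_on \<Omega>) (\<lambda>x. (f x)\<^sup>2)"
  by (simp_all add: L2_def)

lemma L2_add:
  assumes "f \<in> L2 \<Omega>" "g \<in> L2 \<Omega>"
  shows "(\<lambda>x. f x + g x) \<in> L2 \<Omega>"
proof -
  note [measurable] = L2_measurable[OF assms(1)] L2_measurable[OF assms(2)]
  have "integrable (lebesgue_on \<Omega>) (\<lambda>x. (f x + g x)\<^sup>2)"
  proof (rule Bochner_Integration.integrable_bound)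
    show "integrable (lebesgue_on \<Omega>) (\<lambda>x. 2 * (f x)\<^sup>2 + 2 * (g x)\<^sup>2)"
      using L2_square_integrable[OF assms(1)] L2_square_integrable[OF assms(2)] by auto
    have "(a + b)\<^sup>2 \<le> 2 * a\<^sup>2 + 2 * b\<^sup>2" for a b :: real
      using zero_le_power2[of "a - b"] by (simp add: power2_eq_square algebra_simps)
    then show "AE x in lebesgue_on \<Omega>. norm ((f x + g x)\<^sup>2) \<le> norm (2 * (f x)\<^sup>2 + 2 * (g x)\<^sup>2)"
      by (intro AE_I2) simp
  qed measurable
  then show ?thesis by (simp add: L2_def)
qed

lemma L2_sum:
  assumes "finite I" "\<And>i. i \<in> I \<Longrightarrow> f i \<in> L2 \<Omega>"
  shows "(\<lambda>x. \<Sum>i\<in>I. f i x) \<in> L2 \<Omega>"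
  using assms
proof (induction I rule: finite_induct)
  case empty
  then show ?case by (simp add: L2_def)
next
  case (insert i I)
  then show ?case by (simp add: L2_add)
qed

text \<open>
  Needed because \<open>weak_deriv\<close> is an arbitrary representative; it inherits measurability from a
  square-integrable one by completeness of Lebesgue measure.
\<close>

lemma L2_AE_cong:
  fixes f g :: "'a::euclidean_space \<Rightarrow> real"
  assumes "f \<in> L2 \<Omega>" "AE x in lebesgue. x \<in> \<Omega> \<longrightarrow> g x = f x" and \<Omega>: "\<Omega> \<in> sets lebesgue"
  shows "g \<in> L2 \<Omega>"
proof -
  note fm[measurable] = L2_measurable[OF assms(1)]
  have gm[measurable]: "g \<in> borel_measurable (lebesgue_on \<Omega>)"
    by (rule measurable_lebesgue_on_AE_cong[OF fm assms(2) \<Omega>])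
  have "AE x in lebesgue_on \<Omega>. (f x)\<^sup>2 = (g x)\<^sup>2"
    unfolding AE_lebesgue_on_iff[OF \<Omega>] using assms(2) by eventually_elim auto
  then have "integrable (lebesgue_on \<Omega>) (\<lambda>x. (g x)\<^sup>2)"
    using integrable_cong_AE[of "\<lambda>x. (f x)\<^sup>2" "lebesgue_on \<Omega>" "\<lambda>x. (g x)\<^sup>2"] L2_square_integrable[OF assms(1)]
    by simp
  then show ?thesis using gm by (simp add: L2_def)
qed

lemma young_abs: "2 * \<bar>a\<bar> \<le> s + a\<^sup>2 / s" if "s > 0" for a s :: real
proof -
  have "0 \<le> (\<bar>a\<bar> - s)\<^sup>2 / s" using that by simp
  also have "\<dots> = s + a\<^sup>2 / s - 2 * \<bar>a\<bar>"
    using that by (simp add: power2_diff field_simps) (simp add: power2_eq_square)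
  finally show ?thesis by simp
qed

lemma L2_integrable:
  fixes f :: "'a::euclidean_space \<Rightarrow> real"
  assumes f: "f \<in> L2 \<Omega>" and \<Omega>: "\<Omega> \<in> lmeasurable"
  shows "integrable (lebesgue_on \<Omega>) f"
proof (rule Bochner_Integration.integrable_bound[OF _ L2_measurable[OF f]])
  interpret finite_measure "lebesgue_on \<Omega>" by (rule finite_measure_lebesgue_on[OF \<Omega>])
  show "integrable (lebesgue_on \<Omega>) (\<lambda>x. 1 + (f x)\<^sup>2)"
    using L2_square_integrable[OF f] by auto
  show "AE x in lebesgue_on \<Omega>. norm (f x) \<le> norm (1 + (f x)\<^sup>2)"
    using young_abs[of 1] by (intro AE_I2) (smt (verit) real_norm_def div_by_1 zero_le_power2)
qed

text \<open>
  The free parameter \<open>s\<close> lets this serve in place of the Cauchy-Schwarz inequality: if the \<open>L2\<close> norms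
  tend to zero, then letting \<open>s\<close> tend to zero afterwards shows that so do the integrals.
\<close>

lemma L2_integral_bound:
  fixes f :: "'a::euclidean_space \<Rightarrow> real"
  assumes f: "f \<in> L2 \<Omega>" and \<Omega>: "\<Omega> \<in> lmeasurable" and s: "s > 0"
  shows "2 * \<bar>LINT x|lebesgue_on \<Omega>. f x\<bar> \<le> s * measure lebesgue \<Omega> + (LINT x|lebesgue_on \<Omega>. (f x)\<^sup>2) / s"
proof -
  interpret finite_measure "lebesgue_on \<Omega>" by (rule finite_measure_lebesgue_on[OF \<Omega>])
  have b: "integrable (lebesgue_on \<Omega>) (\<lambda>x. s + (f x)\<^sup>2 / s)"
    using L2_square_integrable[OF f] by auto
  have "2 * \<bar>LINT x|lebesgue_on \<Omega>. f x\<bar> \<le> 2 * (LINT x|lebesgue_on \<Omega>. \<bar>f x\<bar>)"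
    using integral_abs_bound[of "lebesgue_on \<Omega>" f] by simp
  also have "\<dots> = (LINT x|lebesgue_on \<Omega>. 2 * \<bar>f x\<bar>)" by simp
  also have "\<dots> \<le> (LINT x|lebesgue_on \<Omega>. s + (f x)\<^sup>2 / s)"
    using L2_integrable[OF f \<Omega>] young_abs[OF s] by (intro integral_mono b) auto
  also have "\<dots> = s * measure lebesgue \<Omega> + (LINT x|lebesgue_on \<Omega>. (f x)\<^sup>2) / s"
    using L2_square_integrable[OF f] \<Omega> by (simp add: measure_restrict_space fmeasurableD mult.commute)
  finally show ?thesis .
qed

section \<open>Weak Laplacians of Sobolev functions\<close>

lemma H2_has_weak_deriv:
  assumes "u \<in> H2 \<Omega>" "bs \<in> lists Basis" "length bs \<le> 2"
  shows "has_weak_deriv \<Omega> bs u (weak_deriv \<Omega> bs u)"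
proof -
  obtain g where "has_weak_deriv \<Omega> bs u g"
    using assms unfolding H2_def by blast
  then show ?thesis by (rule has_weak_deriv_weak_deriv)
qed

lemma H2_weak_deriv_L2:
  assumes "open \<Omega>" "u \<in> H2 \<Omega>" "bs \<in> lists Basis" "length bs \<le> 2"
  shows "weak_deriv \<Omega> bs u \<in> L2 \<Omega>"
proof -
  obtain g where "g \<in> L2 \<Omega>" "has_weak_deriv \<Omega> bs u g"
    using assms unfolding H2_def by blast
  then show ?thesis
    using assms(1) by (intro L2_AE_cong[OF _ weak_deriv_AE_eq]) auto
qed

lemma weak_laplacian_L2:
  fixes u :: "'a::euclidean_space \<Rightarrow> real"
  assumes "open \<Omega>" "u \<in> H2 \<Omega>"
  shows "weak_laplacian \<Omega> u \<in> L2 \<Omega>"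
  unfolding weak_laplacian_def by (intro L2_sum H2_weak_deriv_L2 assms) auto

lemma weak_deriv_square_integral_le_H2_norm:
  fixes u :: "'a::euclidean_space \<Rightarrow> real"
  assumes "bs \<in> lists Basis" "length bs \<le> 2"
  shows "(LINT x|lebesgue_on \<Omega>. (weak_deriv \<Omega> bs u x)\<^sup>2) \<le> (H2_norm \<Omega> u)\<^sup>2"
proof -
  let ?I = "{bs \<in> lists Basis. length bs \<le> 2} :: 'a list set"
  have "finite ?I"
    using finite_lists_length_le[of "Basis :: 'a set" 2] by (simp add: lists_eq_set)
  then have "(LINT x|lebesgue_on \<Omega>. (weak_deriv \<Omega> bs u x)\<^sup>2) \<le> (\<Sum>bs\<in>?I. LINT x|lebesgue_on \<Omega>. (weak_deriv \<Omega> bs u x)\<^sup>2)"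
    using assms by (intro member_le_sum) auto
  also have "\<dots> = (H2_norm \<Omega> u)\<^sup>2"
    unfolding H2_norm_def by (intro real_sqrt_pow2[symmetric] sum_nonneg integral_nonneg_AE) auto
  finally show ?thesis .
qed

text \<open>
  For the approximating test functions the integral vanishes, and \<open>H2\<close> convergence implies convergence
  of the integrals of the second derivatives on a set of finite measure.
\<close>

lemma H2_0_integral_second_deriv:
  fixes u :: "'a::euclidean_space \<Rightarrow> real"
  assumes \<Omega>: "open \<Omega>" "bounded \<Omega>" and u: "u \<in> H2_0 \<Omega>" and b: "b \<in> Basis"
  shows "(LINT x|lebesgue_on \<Omega>. weak_deriv \<Omega> [b, b] u x) = 0"
proof -
  have \<Omega>m: "\<Omega> \<in> lmeasurable" and \<Omega>s: "\<Omega> \<in> sets lebesgue"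
    using \<Omega> by (auto simp: lmeasurable_open)
  have bs: "[b, b] \<in> lists Basis" "length [b, b] \<le> 2" using b by auto
  have uH: "u \<in> H2 \<Omega>" using u by (simp add: H2_0_def)
  obtain \<phi> where \<phi>: "\<And>k. \<phi> k \<in> test_functions \<Omega>" and lim: "(\<lambda>k. H2_norm \<Omega> (\<lambda>x. u x - \<phi> k x)) \<longlonglongrightarrow> 0"
    using u unfolding H2_0_def by blast
  let ?N = "\<lambda>k. H2_norm \<Omega> (\<lambda>x. u x - \<phi> k x)"
  define g where "g = weak_deriv \<Omega> [b, b] u"
  define I where "I = (LINT x|lebesgue_on \<Omega>. g x)"
  have gi: "integrable (lebesgue_on \<Omega>) g"
    unfolding g_def by (rule L2_integrable[OF H2_weak_deriv_L2[OF \<Omega>(1) uH bs] \<Omega>m])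
  have main: "2 * \<bar>I\<bar> \<le> s * measure lebesgue \<Omega> + (?N k)\<^sup>2 / s" if s: "s > 0" for s k
  proof -
    have \<phi>U: "\<phi> k \<in> test_functions UNIV" by (rule test_functions_mono[OF subset_UNIV \<phi>])
    obtain K where K: "smooth (\<phi> k)" "compact K" "K \<subseteq> \<Omega>" "\<And>x. x \<notin> K \<Longrightarrow> \<phi> k x = 0"
      using test_functionsE[OF \<phi>[of k]] by blast
    let ?d = "iter_partial [b, b] (\<phi> k)"
    have d: "?d \<in> test_functions UNIV" by (rule test_functions_iter_partial[OF \<phi>U bs(1)])
    define h where "h = weak_deriv \<Omega> [b, b] (\<lambda>x. u x - \<phi> k x)"
    have wd: "has_weak_deriv \<Omega> [b, b] (\<lambda>x. u x - \<phi> k x) (\<lambda>x. g x - ?d x)"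
      unfolding g_def by (rule has_weak_deriv_diff[OF \<Omega>s bs(1) H2_has_weak_deriv[OF uH bs] has_weak_deriv_test_function[OF \<Omega>(1) \<phi>U b]])
    have ae: "AE x in lebesgue. x \<in> \<Omega> \<longrightarrow> h x = g x - ?d x"
      unfolding h_def by (rule weak_deriv_AE_eq[OF \<Omega>(1) wd])
    have d0: "(LINT x|lebesgue_on \<Omega>. ?d x) = 0"
    proof -
      have out: "?d x = 0" if "x \<notin> K" for x
        by (rule iter_partial_eq_0_outside[OF compact_imp_closed[OF K(2)] K(4) that])
      have "(LINT x|lebesgue_on \<Omega>. 1 * ?d x) = (LINT x|lebesgue_on UNIV. 1 * ?d x)"
        by (rule lebesgue_on_integral_eq_if_compact_support[OF \<Omega>s _ K(3) subset_UNIV out]) simp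
      also have "\<dots> = 0"
        using integral_partial_deriv_test_function[OF test_functions_partial_deriv[OF \<phi>U b] b]
        by (simp add: lebesgue_on_UNIV_eq)
      finally show ?thesis by simp
    qed
    have di: "integrable (lebesgue_on \<Omega>) ?d"
      using integrable_test_function[OF d] \<Omega>s 
      by (simp add: integrable_restrict_space integrable_indicator_mult del: iter_partial_Cons)
    have d2: "integrable (lebesgue_on \<Omega>) (\<lambda>x. (- ?d x)\<^sup>2)"
    proof -
      obtain M where M: "\<And>x. \<bar>?d x\<bar> \<le> M" using test_functions_bounded[OF d] by blast
      have "integrable lebesgue (\<lambda>x. ?d x * ?d x)"
        by (rule integrable_mult_bounded[OF integrable_test_function[OF d] test_functions_measurable[OF d] M])
      then show ?thesis using \<Omega>s 
        by (simp add: integrable_restrict_space integrable_indicator_mult power2_eq_square del: iter_partial_Cons)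
    qed
    have "(\<lambda>x. g x + - ?d x) \<in> L2 \<Omega>"
    proof (rule L2_add)
      show "g \<in> L2 \<Omega>" unfolding g_def by (rule H2_weak_deriv_L2[OF \<Omega>(1) uH bs])
      show "(\<lambda>x. - ?d x) \<in> L2 \<Omega>"
        using d2 di unfolding L2_def by (auto simp del: iter_partial_Cons)
    qed
    then have hL: "h \<in> L2 \<Omega>"
      by (rule L2_AE_cong[OF _ _ \<Omega>s]) (use ae in \<open>simp only: add_uminus_conv_diff\<close>)
    have "(LINT x|lebesgue_on \<Omega>. h x) = (LINT x|lebesgue_on \<Omega>. g x - ?d x)"
    proof (rule integral_cong_AE)
      show "AE x in lebesgue_on \<Omega>. h x = g x - ?d x"
        unfolding AE_lebesgue_on_iff[OF \<Omega>s] by (rule ae)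
    qed (use L2_measurable[OF hL] gi di in \<open>auto simp del: iter_partial_Cons\<close>)
    also have "\<dots> = I"
      using gi di d0 by (simp add: I_def del: iter_partial_Cons)
    finally have "2 * \<bar>I\<bar> \<le> s * measure lebesgue \<Omega> + (LINT x|lebesgue_on \<Omega>. (h x)\<^sup>2) / s"
      using L2_integral_bound[OF hL \<Omega>m s] by simp
    also have "\<dots> \<le> s * measure lebesgue \<Omega> + (?N k)\<^sup>2 / s"
      using weak_deriv_square_integral_le_H2_norm[OF bs] s unfolding h_def by (intro add_left_mono divide_right_mono) auto
    finally show ?thesis .
  qed
  have le: "2 * \<bar>I\<bar> \<le> s * measure lebesgue \<Omega>" if s: "s > 0" for s
  proof -
    have "(\<lambda>k. s * measure lebesgue \<Omega> + (?N k)\<^sup>2 / s) \<longlonglongrightarrow> s * measure lebesgue \<Omega> + 0\<^sup>2 / s"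
      using s by (intro tendsto_intros lim) auto
    then have "2 * \<bar>I\<bar> \<le> s * measure lebesgue \<Omega> + 0\<^sup>2 / s"
      by (rule LIMSEQ_le_const) (use main[OF s] in auto)
    then show ?thesis by simp
  qed
  have "2 * \<bar>I\<bar> \<le> 0"
  proof (rule field_le_epsilon)
    fix e :: real assume e: "e > 0"
    let ?m = "measure lebesgue \<Omega>"
    have m: "?m + 1 > 0" by (simp add: add_nonneg_pos)
    have "2 * \<bar>I\<bar> \<le> e / (?m + 1) * ?m" using e m by (intro le) auto
    also have "\<dots> \<le> e / (?m + 1) * (?m + 1)" using e m by (intro mult_left_mono) auto
    also have "\<dots> = 0 + e" using m by simp
    finally show "2 * \<bar>I\<bar> \<le> 0 + e" .
  qed
  then show ?thesis by (simp add: I_def g_def)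
qed

lemma H2_0_integral_laplacian:
  fixes u :: "'a::euclidean_space \<Rightarrow> real"
  assumes \<Omega>: "open \<Omega>" "bounded \<Omega>" and u: "u \<in> H2_0 \<Omega>"
  shows "(LINT x|lebesgue_on \<Omega>. weak_laplacian \<Omega> u x) = 0"
proof -
  have "u \<in> H2 \<Omega>" using u by (simp add: H2_0_def)
  then have "integrable (lebesgue_on \<Omega>) (weak_deriv \<Omega> [b, b] u)" if "b \<in> Basis" for b
    using that \<Omega> by (intro L2_integrable[OF H2_weak_deriv_L2] lmeasurable_open) auto
  then show ?thesis
    unfolding weak_laplacian_def using H2_0_integral_second_deriv[OF \<Omega> u]
    by (subst Bochner_Integration.integral_sum) auto
qed

text \<open>
  Up to a null set, the zero set of \<open>v\<close> is contained in those of its first derivatives, and these in turn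
  in the zero sets of the pure second derivatives.
\<close>

lemma weak_laplacian_eq_0_on_zeros:
  fixes v :: "'a::euclidean_space \<Rightarrow> real"
  assumes \<Omega>: "open \<Omega>" and v: "v \<in> H2 \<Omega>"
  shows "AE x in lebesgue. x \<in> \<Omega> \<longrightarrow> v x = 0 \<longrightarrow> weak_laplacian \<Omega> v x = 0"
proof -
  have "AE x in lebesgue. x \<in> \<Omega> \<longrightarrow> v x = 0 \<longrightarrow> weak_deriv \<Omega> [b, b] v x = 0" if b: "b \<in> Basis" for b
  proof -
    let ?g = "weak_deriv \<Omega> [b] v" and ?h = "weak_deriv \<Omega> [b, b] v"
    have g: "has_weak_deriv \<Omega> [b] v ?g" and h: "has_weak_deriv \<Omega> [b, b] v ?h"
      using H2_has_weak_deriv[OF v] b by auto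
    \<comment> \<open>partial derivatives of test functions are test functions and may be used to test ?g\<close>
    have gh: "has_weak_deriv \<Omega> [b] ?g ?h"
      unfolding has_weak_deriv_def
    proof (intro conjI ballI)
      show "?g locally_integrable_on \<Omega>" "?h locally_integrable_on \<Omega>"
        using g h by (auto simp: has_weak_deriv_def)
      fix \<phi> assume \<phi>: "\<phi> \<in> test_functions \<Omega>"
      have "(LINT x|lebesgue_on \<Omega>. v x * iter_partial [b] (partial_deriv b \<phi>) x) = - (LINT x|lebesgue_on \<Omega>. ?g x * partial_deriv b \<phi> x)"
        using g test_functions_partial_deriv[OF \<phi> b] unfolding has_weak_deriv_def by fastforce
      moreover have "(LINT x|lebesgue_on \<Omega>. v x * iter_partial [b, b] \<phi> x) = (LINT x|lebesgue_on \<Omega>. ?h x * \<phi> x)"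
        using h \<phi> unfolding has_weak_deriv_def by fastforce
      ultimately show "(LINT x|lebesgue_on \<Omega>. ?g x * iter_partial [b] \<phi> x) = (- 1) ^ length [b] * (LINT x|lebesgue_on \<Omega>. ?h x * \<phi> x)"
        by simp
    qed
    show ?thesis
      using weak_deriv_eq_0_on_zeros[OF \<Omega> b g] weak_deriv_eq_0_on_zeros[OF \<Omega> b gh]
      by eventually_elim auto
  qed
  then have "AE x in lebesgue. \<forall>b\<in>Basis. x \<in> \<Omega> \<longrightarrow> v x = 0 \<longrightarrow> weak_deriv \<Omega> [b, b] v x = 0"
    by (intro AE_finite_allI) auto
  then show ?thesis
    unfolding weak_laplacian_def by eventually_elim auto
qed

lemma weak_laplacian_diff_AE:
  fixes v :: "'a::euclidean_space \<Rightarrow> real"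
  assumes \<Omega>: "open \<Omega>" and v: "v \<in> H2 \<Omega>" and w: "w \<in> H2 \<Omega>"
  shows "AE x in lebesgue. x \<in> \<Omega> \<longrightarrow> weak_laplacian \<Omega> (\<lambda>x. v x - w x) x = weak_laplacian \<Omega> v x - weak_laplacian \<Omega> w x"
proof -
  have "AE x in lebesgue. x \<in> \<Omega> \<longrightarrow> weak_deriv \<Omega> [b, b] (\<lambda>x. v x - w x) x = weak_deriv \<Omega> [b, b] v x - weak_deriv \<Omega> [b, b] w x"
    if b: "b \<in> Basis" for b
    using b \<Omega> by (intro weak_deriv_AE_eq has_weak_deriv_diff H2_has_weak_deriv v w) auto
  then have "AE x in lebesgue. \<forall>b\<in>Basis. x \<in> \<Omega> \<longrightarrow> weak_deriv \<Omega> [b, b] (\<lambda>x. v x - w x) x = weak_deriv \<Omega> [b, b] v x - weak_deriv \<Omega> [b, b] w x"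
    by (intro AE_finite_allI) auto
  then show ?thesis
    unfolding weak_laplacian_def by eventually_elim (auto simp: sum_subtractf)
qed

lemma H2_loc_imp_H2:
  assumes "w \<in> H2_loc UNIV" "open \<Omega>" "bounded \<Omega>"
  shows "w \<in> H2 \<Omega>"
  using assms unfolding H2_loc_def by (simp add: compact_closure)

text \<open>
  The Laplacian on the whole space refers to arbitrarily chosen global weak derivatives. Their existence
  is not part of local membership in \<open>H2\<close> and comes from gluing; their restrictions are then weak
  derivatives on \<open>\<Omega>\<close>.
\<close>

lemma weak_laplacian_restrict_AE:
  fixes w :: "'a::euclidean_space \<Rightarrow> real"
  assumes w: "w \<in> H2_loc UNIV" and \<Omega>: "open \<Omega>" "bounded \<Omega>"
  shows "AE x in lebesgue. x \<in> \<Omega> \<longrightarrow> weak_laplacian \<Omega> w x = weak_laplacian UNIV w x"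
proof -
  have "AE x in lebesgue. x \<in> \<Omega> \<longrightarrow> weak_deriv \<Omega> [b, b] w x = weak_deriv UNIV [b, b] w x" if b: "b \<in> Basis" for b
  proof (rule weak_deriv_AE_eq[OF \<Omega>(1)])
    have "has_weak_deriv (ball 0 (real (Suc k))) [b, b] w (weak_deriv (ball 0 (real (Suc k))) [b, b] w)" for k
      using b by (intro H2_has_weak_deriv H2_loc_imp_H2[OF w]) auto
    then have "\<exists>G. has_weak_deriv UNIV [b, b] w G"
      by (rule has_weak_deriv_UNIV_if_balls)
    then obtain G where "has_weak_deriv UNIV [b, b] w G" ..
    then have "has_weak_deriv UNIV [b, b] w (weak_deriv UNIV [b, b] w)"
      by (rule has_weak_deriv_weak_deriv)
    then show "has_weak_deriv \<Omega> [b, b] w (weak_deriv UNIV [b, b] w)"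
      by (rule has_weak_deriv_subset[OF _ _ _ subset_UNIV]) (simp_all add: \<Omega>(1))
  qed
  then have "AE x in lebesgue. \<forall>b\<in>Basis. x \<in> \<Omega> \<longrightarrow> weak_deriv \<Omega> [b, b] w x = weak_deriv UNIV [b, b] w x"
    by (intro AE_finite_allI) auto
  then show ?thesis
    unfolding weak_laplacian_def by eventually_elim auto
qed


section \<open>Functions of constant Laplacian are global minimizers\<close>

theorem theorem2:
  fixes w :: "real ^ 'n \<Rightarrow> real" and C :: real
  assumes "w \<in> H2_loc UNIV"
    and "AE x in lebesgue. weak_laplacian UNIV w x = C"
    and "C \<in> {..-1} \<union> {1..}"
  shows "global_minimizer w"
  unfolding global_minimizer_def
proof (intro conjI allI impI, fact assms(1), elim conjE)
  fix \<Omega> :: "(real ^ 'n) set" and v :: "real ^ 'n \<Rightarrow> real"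
  assume \<Omega>: "open \<Omega>" "bounded \<Omega>" and v: "v \<in> H2 \<Omega>" and vw: "(\<lambda>x. v x - w x) \<in> H2_0 \<Omega>"
  have \<Omega>m: "\<Omega> \<in> lmeasurable" and \<Omega>s: "\<Omega> \<in> sets lebesgue"
    using \<Omega> by (auto simp: lmeasurable_open)
  interpret finite_measure "lebesgue_on \<Omega>" by (rule finite_measure_lebesgue_on[OF \<Omega>m])
  have w: "w \<in> H2 \<Omega>" by (rule H2_loc_imp_H2[OF assms(1) \<Omega>])
  have C2: "C\<^sup>2 \<ge> 1"
    using assms(3) abs_le_square_iff[of 1 C] by auto
  define \<psi> where "\<psi> = weak_laplacian \<Omega> (\<lambda>x. v x - w x)"
  have \<psi>2: "\<psi> \<in> L2 \<Omega>"
    unfolding \<psi>_def using vw by (intro weak_laplacian_L2 \<Omega>(1)) (simp add: H2_0_def)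
  have \<psi>i: "integrable (lebesgue_on \<Omega>) \<psi>"
    by (rule L2_integrable[OF \<psi>2 \<Omega>m])
  have \<psi>0: "(LINT x|lebesgue_on \<Omega>. \<psi> x) = 0"
    unfolding \<psi>_def by (rule H2_0_integral_laplacian[OF \<Omega> vw])
  have lw: "AE x in lebesgue_on \<Omega>. weak_laplacian \<Omega> w x = C"
    unfolding AE_lebesgue_on_iff[OF \<Omega>s]
    using weak_laplacian_restrict_AE[OF assms(1) \<Omega>] assms(2) by eventually_elim auto
  have "AE x in lebesgue_on \<Omega>. \<psi> x = weak_laplacian \<Omega> v x - weak_laplacian \<Omega> w x"
    unfolding AE_lebesgue_on_iff[OF \<Omega>s] \<psi>_def by (rule weak_laplacian_diff_AE[OF \<Omega>(1) v w])
  then have lv: "AE x in lebesgue_on \<Omega>. weak_laplacian \<Omega> v x = C + \<psi> x"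
    using lw by eventually_elim simp
  have zero: "AE x in lebesgue_on \<Omega>. v x = 0 \<longrightarrow> weak_laplacian \<Omega> v x = 0"
    unfolding AE_lebesgue_on_iff[OF \<Omega>s] by (rule weak_laplacian_eq_0_on_zeros[OF \<Omega>(1) v])
  define Z where "Z = {x \<in> \<Omega>. v x = 0}"
  have vm[measurable]: "v \<in> borel_measurable (lebesgue_on \<Omega>)"
    using v by (simp add: H2_def L2_measurable)
  have Z: "Z \<in> sets (lebesgue_on \<Omega>)"
  proof -
    have "{x \<in> space (lebesgue_on \<Omega>). v x = 0} \<in> sets (lebesgue_on \<Omega>)" by measurable
    then show ?thesis by (simp add: Z_def)
  qed
  note lm = L2_measurable[OF weak_laplacian_L2[OF \<Omega>(1) w]] L2_measurable[OF weak_laplacian_L2[OF \<Omega>(1) v]] L2_measurable[OF \<psi>2]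
  have "(LINT x|lebesgue_on \<Omega>. (weak_laplacian \<Omega> w x)\<^sup>2) = (LINT x|lebesgue_on \<Omega>. C\<^sup>2)"
    by (rule integral_cong_AE) (use lm lw in auto)
  moreover have "(LINT x|lebesgue_on \<Omega>. (weak_laplacian \<Omega> v x)\<^sup>2) = (LINT x|lebesgue_on \<Omega>. C\<^sup>2) + (LINT x|lebesgue_on \<Omega>. (\<psi> x)\<^sup>2)"
  proof -
    have "(LINT x|lebesgue_on \<Omega>. (weak_laplacian \<Omega> v x)\<^sup>2) = (LINT x|lebesgue_on \<Omega>. C\<^sup>2 + (2 * C * \<psi> x + (\<psi> x)\<^sup>2))"
      by (rule integral_cong_AE) (use lm lv in \<open>auto simp: power2_sum\<close>)
    also have "\<dots> = (LINT x|lebesgue_on \<Omega>. C\<^sup>2) + (2 * C * (LINT x|lebesgue_on \<Omega>. \<psi> x) + (LINT x|lebesgue_on \<Omega>. (\<psi> x)\<^sup>2))"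
      using \<psi>i L2_square_integrable[OF \<psi>2] by simp
    finally show ?thesis using \<psi>0 by simp
  qed
  moreover have "measure (lebesgue_on \<Omega>) Z \<le> (LINT x|lebesgue_on \<Omega>. (\<psi> x)\<^sup>2)"
  proof -
    have "AE x in lebesgue_on \<Omega>. indicator Z x \<le> (\<psi> x)\<^sup>2"
      using lv zero
    proof eventually_elim
      case (elim x)
      show ?case
      proof (cases "x \<in> Z")
        case True
        \<comment> \<open>here 0 is the Laplacian of v, that is C plus the Laplacian of v - w\<close>
        then have "\<psi> x = - C" using elim by (simp add: Z_def)
        then show ?thesis using C2 True by simp
      qed simp
    qed
    moreover have "emeasure (lebesgue_on \<Omega>) Z < \<infinity>"
      using emeasure_finite[of Z] by (simp only: less_top infinity_ennreal_def)
    ultimately have "(LINT x|lebesgue_on \<Omega>. indicator Z x) \<le> (LINT x|lebesgue_on \<Omega>. (\<psi> x)\<^sup>2)"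
      by (intro integral_mono_AE integrable_real_indicator Z L2_square_integrable[OF \<psi>2])
    moreover have "Z \<inter> space (lebesgue_on \<Omega>) = Z" by (auto simp: Z_def)
    ultimately show ?thesis using Z by simp
  qed
  moreover have "measure lebesgue {x \<in> \<Omega>. w x \<noteq> 0} \<le> measure lebesgue {x \<in> \<Omega>. v x \<noteq> 0} + measure (lebesgue_on \<Omega>) Z"
  proof -
    have "Z \<in> sets lebesgue" using Z \<Omega>s by (auto simp: sets_restrict_space_iff)
    have Zm: "Z \<in> lmeasurable"
      by (rule fmeasurableI2[OF \<Omega>m]) (use \<open>Z \<in> sets lebesgue\<close> in \<open>auto simp: Z_def\<close>)
    have eq: "{x \<in> \<Omega>. v x \<noteq> 0} = \<Omega> - Z" by (auto simp: Z_def)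
    have "measure lebesgue {x \<in> \<Omega>. w x \<noteq> 0} \<le> measure lebesgue \<Omega>"
    proof -
      have wm[measurable]: "w \<in> borel_measurable (lebesgue_on \<Omega>)"
        using w by (simp add: H2_def L2_measurable)
      have "{x \<in> space (lebesgue_on \<Omega>). w x \<noteq> 0} \<in> sets (lebesgue_on \<Omega>)" by measurable
      then have "{x \<in> \<Omega>. w x \<noteq> 0} \<in> sets lebesgue" using \<Omega>s by (simp add: sets_restrict_space_iff)
      then show ?thesis by (intro measure_mono_fmeasurable \<Omega>m) auto
    qed
    also have "\<dots> = measure lebesgue (\<Omega> - Z) + measure lebesgue Z"
      using \<Omega>m Zm by (subst measurable_measure_Diff) (auto simp: Z_def)
    also have "measure lebesgue Z = measure (lebesgue_on \<Omega>) Z"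
      using \<Omega>s by (subst measure_restrict_space) (auto simp: Z_def)
    finally show ?thesis unfolding eq .
  qed
  \<comment> \<open>the excess of bending energy is at least the measure of the zero set Z of v\<close>
  ultimately show "biharmonic_AC w \<Omega> \<le> biharmonic_AC v \<Omega>"
    unfolding biharmonic_AC_def by linarith
qed

end
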